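(* Let $\mathcal{S} = \mathcal{T} \cup \mathcal{B}_1 \cup \mathcal{B}_2$ be the class of finite groups defined in the context. Then every member of $\mathcal{S}$ is isomorphic to the automorphism group $Aut(\Delta)$ of some bicyclic graph $\Delta$.
   Context: All graphs are finite, simple and undirected. For a connected graph with $n$ vertices and $m$ edges the cyclomatic number is $c = m-n+1$; the graph is a tree if $c=0$ and is bicyclic if $c=2$. Groups are considered up to isomorphism. Wreath product: if a group $H$ acts on a set $X$ and $G$ is a group, $G \wr H$ is the set of pairs $(h;f)$ with $h\in H$ and $f:X\to G$, with product $(h_1;f_1)(h_2;f_2)=(h_1h_2; f_1^{h_2}f_2)$, where $f_1^{h_2}(x)=f_1(x^{h_2})$; that is, the semidirect product $G^X\rtimes H$ with $H$ permuting coordinates. In $G\wr S_n$ the symmetric group $S_n$ acts naturally on $n$ points; in $D\wr(\mathbb{Z}_2\times\mathbb{Z}_2)$ the group $\mathbb{Z}_2\times\mathbb{Z}_2$ acts regularly on itself (4 points). $\mathcal{T}$ is the class of finite groups defined inductively by: (1) $\{1\}\in\mathcal{T}$; (2) if $G_1,G_2\in\mathcal{T}$ then $G_1\times G_2\in\mathcal{T}$; (3) if $G\in\mathcal{T}$ and $n\ge 2$ then $G\wr S_n\in\mathcal{T}$. (By Jordan's theorem, $\mathcal{T}$ is exactly the class of automorphism groups of finite trees.) $\mathcal{B}_1=\{C\times (D\wr(\mathbb{Z}_2\times\mathbb{Z}_2)) \mid C,D\in\mathcal{T}\}$. $\mathcal{B}_2=\{C\times[(D\times D\times D\times D\times H\times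 H\times K\times K)\rtimes_\phi(\mathbb{Z}_2\times\mathbb{Z}_2)] \mid C,D,H,K\in\mathcal{T}\}$, where $\phi:\mathbb{Z}_2\times\mathbb{Z}_2\to Aut(D^4\times H^2\times K^2)$ is the homomorphism given by $\phi(0,0)=\mathrm{id}$ and $\phi(0,1):(\alpha,\beta,\gamma,\delta,\lambda,\lambda',\sigma,\sigma')\mapsto(\gamma,\delta,\alpha,\beta,\lambda,\lambda',\sigma',\sigma)$, $\phi(1,0):(\alpha,\beta,\gamma,\delta,\lambda,\lambda',\sigma,\sigma')\mapsto(\beta,\alpha,\delta,\gamma,\lambda',\lambda,\sigma,\sigma')$, $\phi(1,1):(\alpha,\beta,\gamma,\delta,\lambda,\lambda',\sigma,\sigma')\mapsto(\delta,\gamma,\beta,\alpha,\lambda',\lambda,\sigma',\sigma)$. *)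

theory Defs
  imports "HOL-Algebra.Algebra"
begin

section \<open>Wreath and semidirect products\<close>

text \<open>
  The wreath product of \<open>G\<close> by \<open>H\<close>, where \<open>H\<close> acts on the set \<open>\<Omega>\<close> through \<open>\<phi>\<close>. The action is
  written on the left: the point called \<open>x^h\<close> in exponential notation is \<open>\<phi> h x\<close>. With
  \<open>(h1; f1) (h2; f2) = (h1 h2; f1^h2 f2)\<close> and \<open>f1^h2 (x) = f1 (x^h2)\<close>, associativity requires
  \<open>x^(h h') = (x^h')^h\<close>, i.e. a left action.
\<close>

definition wreath ::
  "('a, 'm) monoid_scheme \<Rightarrow> ('h, 'n) monoid_scheme \<Rightarrow> 'x set \<Rightarrow> ('h \<Rightarrow> 'x \<Rightarrow> 'x)
    \<Rightarrow> ('h \<times> ('x \<Rightarrow> 'a)) monoid"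
  where
  "wreath G H \<Omega> \<phi> =
    \<lparr>carrier = carrier H \<times> (\<Omega> \<rightarrow>\<^sub>E carrier G),
     monoid.mult = (\<lambda>(h1, f1) (h2, f2). (h1 \<otimes>\<^bsub>H\<^esub> h2, \<lambda>x\<in>\<Omega>. f1 (\<phi> h2 x) \<otimes>\<^bsub>G\<^esub> f2 x)),
     one = (\<one>\<^bsub>H\<^esub>, \<lambda>x\<in>\<Omega>. \<one>\<^bsub>G\<^esub>)\<rparr>"

definition wreath_sym ::
  "('a, 'm) monoid_scheme \<Rightarrow> nat \<Rightarrow> ((nat \<Rightarrow> nat) \<times> (nat \<Rightarrow> 'a)) monoid"
  where "wreath_sym G n = wreath G (sym_group n) {1..n} (\<lambda>p. p)"

definition Z2xZ2 :: "(int \<times> int) monoid"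
  where "Z2xZ2 = integer_mod_group 2 \<times>\<times> integer_mod_group 2"

text \<open>\<open>Z2xZ2\<close> acts on its own carrier by translation, i.e. regularly.\<close>

definition wreath_Z2xZ2 ::
  "('a, 'm) monoid_scheme \<Rightarrow> ((int \<times> int) \<times> (int \<times> int \<Rightarrow> 'a)) monoid"
  where "wreath_Z2xZ2 G = wreath G Z2xZ2 (carrier Z2xZ2) (\<lambda>h x. h \<otimes>\<^bsub>Z2xZ2\<^esub> x)"

definition semidirect ::
  "('a, 'm) monoid_scheme \<Rightarrow> ('h, 'n) monoid_scheme \<Rightarrow> ('h \<Rightarrow> 'a \<Rightarrow> 'a) \<Rightarrow> ('a \<times> 'h) monoid"
  where
  "semidirect N H \<phi> =
    \<lparr>carrier = carrier N \<times> carrier H,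
     monoid.mult = (\<lambda>(n1, h1) (n2, h2). (n1 \<otimes>\<^bsub>N\<^esub> \<phi> h1 n2, h1 \<otimes>\<^bsub>H\<^esub> h2)),
     one = (\<one>\<^bsub>N\<^esub>, \<one>\<^bsub>H\<^esub>)\<rparr>"


section \<open>The classes of groups\<close>

text \<open>
  The class \<open>\<T>\<close> of groups up to isomorphism. All its members are finite, so each of them has a
  copy whose elements are natural numbers. The inductive generation takes place among such
  copies, since it would otherwise change the type of the elements at every step. The class is
  then transported along isomorphisms to arbitrary element types.
\<close>

inductive_set \<T>_nat :: "nat monoid set" where
  trivial: "\<lbrakk>group G; carrier G = {\<one>\<^bsub>G\<^esub>}\<rbrakk> \<Longrightarrow> G \<in> \<T>_nat"
| prod: "\<lbrakk>G1 \<in> \<T>_nat; G2 \<in> \<T>_nat; group G; G \<cong> G1 \<times>\<times> G2\<rbrakk> \<Longrightarrow> G \<in> \<T>_nat"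
| wreath: "\<lbrakk>G1 \<in> \<T>_nat; n \<ge> 2; group G; G \<cong> wreath_sym G1 n\<rbrakk> \<Longrightarrow> G \<in> \<T>_nat"

definition \<T> :: "'a monoid set"
  where "\<T> = {G. group G \<and> (\<exists>H\<in>\<T>_nat. G \<cong> H)}"

definition \<B>1 :: "'a monoid set"
  where "\<B>1 = {G. group G \<and> (\<exists>C\<in>\<T>_nat. \<exists>D\<in>\<T>_nat. G \<cong> C \<times>\<times> wreath_Z2xZ2 D)}"

definition phi ::
  "int \<times> int \<Rightarrow> 'd \<times> 'd \<times> 'd \<times> 'd \<times> 'h \<times> 'h \<times> 'k \<times> 'k \<Rightarrow> 'd \<times> 'd \<times> 'd \<times> 'd \<times> 'h \<times> 'h \<times> 'k \<times> 'k"
  where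
  "phi v = (\<lambda>(\<alpha>, \<beta>, \<gamma>, \<delta>, l, l', s, s').
     if v = (0, 1) then (\<gamma>, \<delta>, \<alpha>, \<beta>, l, l', s', s)
     else if v = (1, 0) then (\<beta>, \<alpha>, \<delta>, \<gamma>, l', l, s, s')
     else if v = (1, 1) then (\<delta>, \<gamma>, \<beta>, \<alpha>, l', l, s', s)
     else (\<alpha>, \<beta>, \<gamma>, \<delta>, l, l', s, s'))"

definition \<B>2 :: "'a monoid set"
  where "\<B>2 = {G. group G \<and> (\<exists>C\<in>\<T>_nat. \<exists>D\<in>\<T>_nat. \<exists>H\<in>\<T>_nat. \<exists>K\<in>\<T>_nat.
     G \<cong> C \<times>\<times> semidirect (D \<times>\<times> D \<times>\<times> D \<times>\<times> D \<times>\<times> H \<times>\<times> H \<times>\<times> K \<times>\<times> K) Z2xZ2 phi)}"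

definition \<S> :: "'a monoid set"
  where "\<S> = \<T> \<union> \<B>1 \<union> \<B>2"


section \<open>Bicyclic graphs and automorphism groups\<close>

definition simple_graph :: "'v set \<Rightarrow> 'v set set \<Rightarrow> bool"
  where "simple_graph V E \<longleftrightarrow> finite V \<and> (\<forall>e\<in>E. e \<subseteq> V \<and> card e = 2)"

definition connected_graph :: "'v set \<Rightarrow> 'v set set \<Rightarrow> bool"
  where "connected_graph V E \<longleftrightarrow>
    V \<noteq> {} \<and> (\<forall>u\<in>V. \<forall>v\<in>V. (u, v) \<in> {(x, y). {x, y} \<in> E}\<^sup>*)"

definition cyclomatic_number :: "'v set \<Rightarrow> 'v set set \<Rightarrow> int"
  where "cyclomatic_number V E = int (card E) - int (card V) + 1"

definition bicyclic :: "'v set \<Rightarrow> 'v set set \<Rightarrow> bool"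
  where "bicyclic V E \<longleftrightarrow>
    simple_graph V E \<and> connected_graph V E \<and> cyclomatic_number V E = 2"

definition Aut :: "'v set \<Rightarrow> 'v set set \<Rightarrow> ('v \<Rightarrow> 'v) monoid"
  where "Aut V E = (BijGroup V)
    \<lparr>carrier := {f \<in> Bij V. \<forall>u\<in>V. \<forall>v\<in>V. {f u, f v} \<in> E \<longleftrightarrow> {u, v} \<in> E}\<rparr>"


section \<open>Well-definedness\<close>

lemma group_wreath:
  assumes "group G" "group H"
    and cl: "\<And>h x. \<lbrakk>h \<in> carrier H; x \<in> \<Omega>\<rbrakk> \<Longrightarrow> act h x \<in> \<Omega>"
    and one: "\<And>x. x \<in> \<Omega> \<Longrightarrow> act \<one>\<^bsub>H\<^esub> x = x"
    and mult: "\<And>h h' x. \<lbrakk>h \<in> carrier H; h' \<in> carrier H; x \<in> \<Omega>\<rbrakk>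
      \<Longrightarrow> act (h \<otimes>\<^bsub>H\<^esub> h') x = act h (act h' x)"
  shows "group (wreath G H \<Omega> act)"
proof -
  interpret G: group G by fact
  interpret H: group H by fact
  show ?thesis
  proof (rule groupI, goal_cases)
    case (1 x y)
    then show ?case by (auto simp: wreath_def PiE_iff cl)
  next
    case 2
    then show ?case by (auto simp: wreath_def)
  next
    case (3 x y z)
    then show ?case
      by (auto simp: wreath_def PiE_iff cl mult H.m_assoc G.m_assoc intro!: restrict_ext)
  next
    case (4 x)
    then show ?case
      by (auto simp: wreath_def PiE_iff cl fun_eq_iff extensional_def)
  next
    case (5 x)
    then obtain h f where x: "x = (h, f)" and h: "h \<in> carrier H" and f: "f \<in> \<Omega> \<rightarrow>\<^sub>E carrier G"
      by (auto simp: wreath_def)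
    define y where "y = (inv\<^bsub>H\<^esub> h, \<lambda>x\<in>\<Omega>. inv\<^bsub>G\<^esub> f (act (inv\<^bsub>H\<^esub> h) x))"
    have "y \<in> carrier (wreath G H \<Omega> act)"
      using h f by (auto simp: y_def wreath_def PiE_iff cl)
    moreover have "act (inv\<^bsub>H\<^esub> h) (act h z) = z" if "z \<in> \<Omega>" for z
      using mult[of "inv\<^bsub>H\<^esub> h" h z] that h one by simp
    then have "y \<otimes>\<^bsub>wreath G H \<Omega> act\<^esub> x = \<one>\<^bsub>wreath G H \<Omega> act\<^esub>"
      using h f by (auto simp: x y_def wreath_def PiE_iff cl intro!: restrict_ext)
    ultimately show ?case by blast
  qed
qed

lemma group_Z2xZ2: "group Z2xZ2"
  by (simp add: Z2xZ2_def DirProd_group)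

lemma carrier_Z2xZ2: "carrier Z2xZ2 = {0, 1} \<times> {0, 1}"
  by (auto simp: Z2xZ2_def carrier_integer_mod_group)

lemma group_wreath_sym: "group G \<Longrightarrow> group (wreath_sym G n)"
  unfolding wreath_sym_def
  by (rule group_wreath)
    (auto simp: sym_group_is_group sym_group_carrier sym_group_one sym_group_mult
      simp del: atLeastAtMost_iff simp: permutes_in_image)

lemma group_wreath_Z2xZ2: "group G \<Longrightarrow> group (wreath_Z2xZ2 G)"
proof -
  assume "group G"
  interpret Z: group Z2xZ2 by (rule group_Z2xZ2)
  show ?thesis
    unfolding wreath_Z2xZ2_def by (rule group_wreath) (simp_all add: \<open>group G\<close> group_Z2xZ2 Z.m_assoc)
qed

lemma group_semidirect:
  assumes "group N" "group H" and act: "(\<lambda>h. restrict (act h) (carrier N)) \<in> hom H (AutoGroup N)"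
  shows "group (semidirect N H act)"
proof -
  interpret N: group N by fact
  interpret H: group H by fact
  have auto: "restrict (act h) (carrier N) \<in> auto N" if "h \<in> carrier H" for h
    using act that by (auto simp: hom_def AutoGroup_def)
  have cl [simp]: "act h x \<in> carrier N" if "h \<in> carrier H" "x \<in> carrier N" for h x
    using auto[OF that(1)] that(2) by (auto simp: auto_def hom_def Pi_iff)
  have mult: "act h (x \<otimes>\<^bsub>N\<^esub> y) = act h x \<otimes>\<^bsub>N\<^esub> act h y"
    if "h \<in> carrier H" "x \<in> carrier N" "y \<in> carrier N" for h x y
    using auto[OF that(1)] that(2,3) by (auto simp: auto_def hom_def Pi_iff)
  have comp: "act (h \<otimes>\<^bsub>H\<^esub> h') x = act h (act h' x)"
    if "h \<in> carrier H" "h' \<in> carrier H" "x \<in> carrier N" for h h' x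
  proof -
    have "restrict (act (h \<otimes>\<^bsub>H\<^esub> h')) (carrier N)
        = compose (carrier N) (restrict (act h) (carrier N)) (restrict (act h') (carrier N))"
      using act that(1,2) auto by (auto simp: hom_def AutoGroup_def BijGroup_def auto_def)
    from fun_cong[OF this, of x] show ?thesis
      using that by (simp add: compose_def)
  qed
  have inj: "inj_on (act h) (carrier N)" if "h \<in> carrier H" for h
    using auto[OF that] by (auto simp: auto_def Bij_def bij_betw_def inj_on_def)
  have act_one: "act \<one>\<^bsub>H\<^esub> x = x" if "x \<in> carrier N" for x
    using inj_onD[OF inj[OF H.one_closed], of "act \<one>\<^bsub>H\<^esub> x" x] comp[of "\<one>\<^bsub>H\<^esub>" "\<one>\<^bsub>H\<^esub>" x] that by simp
  show ?thesis
  proof (rule groupI, goal_cases)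
    case (3 x y z)
    then show ?case by (auto simp: semidirect_def mult comp N.m_assoc H.m_assoc)
  next
    case (5 x)
    then obtain n h where x: "x = (n, h)" and nh: "n \<in> carrier N" "h \<in> carrier H"
      by (auto simp: semidirect_def)
    have "(inv\<^bsub>N\<^esub> (act (inv\<^bsub>H\<^esub> h) n), inv\<^bsub>H\<^esub> h) \<in> carrier (semidirect N H act)"
      using nh by (simp add: semidirect_def)
    moreover have "(inv\<^bsub>N\<^esub> (act (inv\<^bsub>H\<^esub> h) n), inv\<^bsub>H\<^esub> h) \<otimes>\<^bsub>semidirect N H act\<^esub> x
        = \<one>\<^bsub>semidirect N H act\<^esub>"
      using nh by (simp add: semidirect_def x)
    ultimately show ?case by blast
  qed (auto simp: semidirect_def act_one)
qed

lemma phi_hom: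
  fixes D :: "'d monoid" and H :: "'h monoid" and K :: "'k monoid"
  assumes "group D" "group H" "group K"
  defines "N \<equiv> D \<times>\<times> D \<times>\<times> D \<times>\<times> D \<times>\<times> H \<times>\<times> H \<times>\<times> K \<times>\<times> K"
  shows "(\<lambda>v. restrict (phi v) (carrier N)) \<in> hom Z2xZ2 (AutoGroup N)"
proof -
  have cl: "phi v x \<in> carrier N" if "x \<in> carrier N" for v x
    using that by (auto simp: phi_def N_def)
  have inv: "phi v (phi v x) = x" for v and x :: "'d \<times> 'd \<times> 'd \<times> 'd \<times> 'h \<times> 'h \<times> 'k \<times> 'k"
    by (cases x) (auto simp: phi_def)
  have bij: "restrict (phi v) (carrier N) \<in> Bij (carrier N)" for v
  proof -
    have "bij_betw (phi v) (carrier N) (carrier N)"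
      by (rule bij_betwI[where g = "phi v"]) (use cl inv in blast)+
    then show ?thesis by (simp add: Bij_def)
  qed
  have "phi v (x \<otimes>\<^bsub>N\<^esub> y) = phi v x \<otimes>\<^bsub>N\<^esub> phi v y" for v x y
    by (cases x; cases y) (auto simp: phi_def N_def)
  moreover have "x \<otimes>\<^bsub>N\<^esub> y \<in> carrier N" if "x \<in> carrier N" "y \<in> carrier N" for x y
    using that assms(1-3) by (auto simp: N_def monoid.m_closed group.is_monoid)
  ultimately have "restrict (phi v) (carrier N) \<in> hom N N" for v
    using cl by (auto simp: hom_def)
  with bij have auto: "restrict (phi v) (carrier N) \<in> auto N" for v
    by (simp add: auto_def)
  have "phi (v \<otimes>\<^bsub>Z2xZ2\<^esub> w) x = phi v (phi w x)"
    if "v \<in> carrier Z2xZ2" "w \<in> carrier Z2xZ2"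
    for v w and x :: "'d \<times> 'd \<times> 'd \<times> 'd \<times> 'h \<times> 'h \<times> 'k \<times> 'k"
    using that unfolding carrier_Z2xZ2
    by (cases x) (auto simp: phi_def Z2xZ2_def integer_mod_group_def)
  then show ?thesis
    using cl auto bij
    by (auto simp: hom_def AutoGroup_def BijGroup_def compose_def intro!: restrict_ext)
qed

lemma group_\<T>_nat: "G \<in> \<T>_nat \<Longrightarrow> group G"
  by (induction rule: \<T>_nat.induct) auto

lemma \<T>_eq_\<T>_nat: "\<T> = \<T>_nat"
proof
  show "\<T>_nat \<subseteq> \<T>"
    unfolding \<T>_def using group_\<T>_nat iso_refl by blast
  have "G \<in> \<T>_nat" if "H \<in> \<T>_nat" "group G" "G \<cong> H" for G H
    using that
  proof (cases rule: \<T>_nat.cases)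
    case trivial
    from \<open>G \<cong> H\<close> obtain f where "bij_betw f (carrier G) (carrier H)"
      by (auto simp: is_iso_def iso_def)
    with trivial have "card (carrier G) = 1"
      by (simp add: bij_betw_same_card)
    then have "carrier G = {\<one>\<^bsub>G\<^esub>}"
      using group.is_monoid[OF \<open>group G\<close>] monoid.one_closed by (metis card_1_singletonE singletonD)
    then show ?thesis using \<open>group G\<close> by (rule \<T>_nat.trivial[rotated])
  qed (use that in \<open>blast intro: \<T>_nat.intros iso_trans\<close>)+
  then show "\<T> \<subseteq> \<T>_nat" by (auto simp: \<T>_def)
qed

lemma group_Aut: "group (Aut V E)"
proof -
  interpret B: group "BijGroup V" by (rule group_BijGroup)
  let ?A = "{f \<in> Bij V. \<forall>u\<in>V. \<forall>v\<in>V. {f u, f v} \<in> E \<longleftrightarrow> {u, v} \<in> E}"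
  have "subgroup ?A (BijGroup V)"
  proof (rule B.subgroupI)
    show "?A \<subseteq> carrier (BijGroup V)" by (auto simp: BijGroup_def)
    show "?A \<noteq> {}" using id_Bij[of V] by force
  next
    fix f assume f: "f \<in> ?A"
    then have "restrict (inv_into V f) V \<in> Bij V" by (simp add: restrict_inv_into_Bij)
    moreover have "{inv_into V f u, inv_into V f v} \<in> E \<longleftrightarrow> {u, v} \<in> E" if "u \<in> V" "v \<in> V" for u v
    proof -
      have "inv_into V f u \<in> V" "inv_into V f v \<in> V" "f (inv_into V f u) = u" "f (inv_into V f v) = v"
        using f that by (auto simp: Bij_inv_into_mem Bij_def bij_betw_def f_inv_into_f)
      with f show ?thesis by force
    qed
    ultimately show "inv\<^bsub>BijGroup V\<^esub> f \<in> ?A" using f by (simp add: inv_BijGroup)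
  next
    fix f g assume "f \<in> ?A" "g \<in> ?A"
    then show "f \<otimes>\<^bsub>BijGroup V\<^esub> g \<in> ?A"
      by (auto simp: BijGroup_def compose_Bij compose_eq Bij_imp_funcset[THEN funcset_mem])
  qed
  then show ?thesis
    unfolding Aut_def by (rule B.subgroup_imp_group)
qed

end

theory Submission
  imports Defs
begin

text \<open>Every group \<open>G \<in> \<T>\<close> is the automorphism group of a rooted tree: joining trees of different
  sizes to a new root gives direct products, joining \<open>n\<close> copies of a tree gives \<open>G \<wr> S\<^sub>n\<close>, and joining
  a single tree enlarges it without changing its group, so the size can be any sufficiently
  large number. Now attach rooted trees to the vertices of a theta graph with paths of lengths 2, 4
  and 4. Automorphisms preserve this core, as it is what remains after the repeated removal of leaves.
  The sizes of the trees control which automorphisms of the core extend: if they are pairwise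
  different, only the tree automorphisms are left; if they are constant on the orbits of the group
  \<open>\<int>\<^sub>2 \<times> \<int>\<^sub>2\<close> of the core, which have sizes 1, 2, 2 and 4, one obtains the groups of the classes
  \<open>\<B>\<^sub>1\<close> and \<open>\<B>\<^sub>2\<close>.\<close>


section \<open>Rooted trees\<close>

text \<open>The chosen theta graph has just two independent symmetries, exchanging the hubs and
  exchanging the long paths, and each factor finds an orbit of its own. The midpoint of the short
  path is fixed and carries \<open>C\<close>, the midpoints of the long paths carry
  \<open>H\<close>, the hubs carry \<open>K\<close>, and the other four vertices form a regular
  orbit for \<open>D\<close>. The class \<B>1 is the case where midpoints and hubs carry trees with
  trivial group. Isomorphism types of trees are never compared. Every family is chosen such that
  trees of equal size are literally equal, so an automorphism amounts to a permutation of the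
  indices and one automorphism per tree. This description serves twice: for trees joined to a new
  root any such permutation is allowed, for trees attached to the core it has to respect adjacency.
  Since both constructions change the type of the vertices, their results are renamed to natural
  numbers.\<close>

datatype 'v rtree = RTree (verts: "'v set") (par: "'v \<Rightarrow> 'v") (root: 'v)

text \<open>A tree is encoded by its parent map, with the root as fixed point. The rank
  \<open>d\<close> rules out cycles, so every vertex leads to the root; any decreasing rank will do,
  which makes it easy to supply one for composite trees.\<close>

definition rooted_tree :: "'v rtree \<Rightarrow> bool"
  where "rooted_tree t \<longleftrightarrow> finite (verts t) \<and> root t \<in> verts t \<and> par t (root t) = root t \<and>
    (\<exists>d :: 'v \<Rightarrow> nat. \<forall>v\<in>verts t. v \<noteq> root t \<longrightarrow> par t v \<in> verts t \<and> d (par t v) < d v)"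

text \<open>In a rooted tree the root is the only fixed point of \<open>par\<close>, so maps
  commuting with \<open>par\<close> preserve it. They are the automorphisms of the tree that fix the
  root, described without edges.\<close>

definition tree_aut :: "'v rtree \<Rightarrow> ('v \<Rightarrow> 'v) monoid"
  where "tree_aut t = (BijGroup (verts t))
    \<lparr>carrier := {f \<in> Bij (verts t). \<forall>v\<in>verts t. f (par t v) = par t (f v)}\<rparr>"

lemma rooted_treeD:
  assumes "rooted_tree t"
  shows "finite (verts t)" "root t \<in> verts t" "par t (root t) = root t"
    "v \<in> verts t \<Longrightarrow> par t v \<in> verts t"
    "v \<in> verts t \<Longrightarrow> par t v = v \<longleftrightarrow> v = root t"
proof -
  obtain d :: "'a \<Rightarrow> nat" where d: "\<forall>v\<in>verts t. v \<noteq> root t \<longrightarrow> par t v \<in> verts t \<and> d (par t v) < d v"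
    using assms by (auto simp: rooted_tree_def)
  show "finite (verts t)" "root t \<in> verts t" "par t (root t) = root t"
    using assms by (auto simp: rooted_tree_def)
  then show "v \<in> verts t \<Longrightarrow> par t v \<in> verts t"
    "v \<in> verts t \<Longrightarrow> par t v = v \<longleftrightarrow> v = root t"
    using d by (metis, metis less_irrefl)
qed

lemma rooted_tree_depth:
  assumes "rooted_tree t"
  obtains d :: "'v \<Rightarrow> nat" where "\<And>v. \<lbrakk>v \<in> verts t; v \<noteq> root t\<rbrakk> \<Longrightarrow> d (par t v) < d v"
  using assms by (auto simp: rooted_tree_def)

lemma rooted_tree_induct [consumes 2, case_names root par]:
  assumes "rooted_tree t" "v \<in> verts t"
    and "Q (root t)"
    and step: "\<And>v. \<lbrakk>v \<in> verts t; v \<noteq> root t; Q (par t v)\<rbrakk> \<Longrightarrow> Q v"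
  shows "Q v"
proof -
  obtain d :: "'a \<Rightarrow> nat" where d: "\<And>v. \<lbrakk>v \<in> verts t; v \<noteq> root t\<rbrakk> \<Longrightarrow> d (par t v) < d v"
    using rooted_tree_depth[OF assms(1)] by blast
  show ?thesis
    using assms(2)
  proof (induction "d v" arbitrary: v rule: less_induct)
    case less
    show ?case
      using assms(3) step[of v] less d rooted_treeD(4)[OF assms(1)] by (cases "v = root t") auto
  qed
qed

text \<open>Conjugation by \<open>h\<close> identifies the bijections of \<open>V\<close> with those
  of \<open>W\<close>, and \<open>AB\<close> says that it matches the two subsets. It serves for
  automorphisms of trees and of graphs alike.\<close>

lemma compose_in_Bij_iso:
  assumes h: "bij_betw h V W"
    and A: "A \<subseteq> Bij V" and B: "B \<subseteq> Bij W"
    and AB: "\<And>f. f \<in> Bij V \<Longrightarrow> f \<in> A \<longleftrightarrow> (\<lambda>y\<in>W. h (f (inv_into V h y))) \<in> B"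
  shows "(BijGroup V)\<lparr>carrier := A\<rparr> \<cong> (BijGroup W)\<lparr>carrier := B\<rparr>"
proof -
  define k where "k = inv_into V h"
  have k: "\<And>y. y \<in> W \<Longrightarrow> k y \<in> V" "\<And>y. y \<in> W \<Longrightarrow> h (k y) = y" "\<And>x. x \<in> V \<Longrightarrow> k (h x) = x"
    and hW: "\<And>x. x \<in> V \<Longrightarrow> h x \<in> W"
    using h unfolding k_def by (auto simp: bij_betw_def inv_into_into f_inv_into_f)
  have kb: "bij_betw k W V" unfolding k_def by (rule bij_betw_inv_into[OF h])
  define F where "F f = (\<lambda>y\<in>W. h (f (k y)))" for f
  define F' where "F' f = (\<lambda>x\<in>V. k (f (h x)))" for f
  have FB: "F f \<in> Bij W" if "f \<in> Bij V" for f
  proof -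
    have "bij_betw (h \<circ> (f \<circ> k)) W W"
      using that h kb by (auto simp: Bij_def intro!: bij_betw_trans)
    then have "bij_betw (F f) W W"
      by (rule bij_betw_cong[THEN iffD1, rotated]) (simp add: F_def)
    then show ?thesis by (simp add: Bij_def F_def)
  qed
  have FB': "F' f \<in> Bij V" if "f \<in> Bij W" for f
  proof -
    have "bij_betw (k \<circ> (f \<circ> h)) V V"
      using that h kb by (auto simp: Bij_def intro!: bij_betw_trans)
    then have "bij_betw (F' f) V V"
      by (rule bij_betw_cong[THEN iffD1, rotated]) (simp add: F'_def)
    then show ?thesis by (simp add: Bij_def F'_def)
  qed
  have mem: "f x \<in> U" if "f \<in> Bij U" "x \<in> U" for f x and U :: "'c set"
    using that by (auto simp: Bij_def bij_betw_def)
  have 1: "F' (F f) = f" if "f \<in> Bij V" for f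
    using that mem[OF that] by (auto simp: F_def F'_def k hW Bij_def extensional_def fun_eq_iff)
  have 2: "F (F' f) = f" if "f \<in> Bij W" for f
    using that mem[OF that] by (auto simp: F_def F'_def k hW Bij_def extensional_def fun_eq_iff)
  have AB': "f \<in> A \<longleftrightarrow> F f \<in> B" if "f \<in> Bij V" for f
    using AB[OF that] by (simp add: F_def k_def)
  have "bij_betw F A B"
    by (rule bij_betwI[where g = F']) (use A B AB' 1 2 FB FB' in \<open>auto simp: subset_iff\<close>)
  moreover have "F (compose V f g) = compose W (F f) (F g)" if "f \<in> Bij V" "g \<in> Bij V" for f g
    using mem[OF that(2)] by (auto simp: F_def compose_def k hW)
  ultimately have "F \<in> iso ((BijGroup V)\<lparr>carrier := A\<rparr>) ((BijGroup W)\<lparr>carrier := B\<rparr>)"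
    using A B FB by (auto simp: iso_def hom_def BijGroup_def bij_betw_def subset_iff image_iff)
  then show ?thesis by (auto simp: is_iso_def)
qed

text \<open>Joining trees turns vertices into options of pairs. Renaming them injectively brings a
  tree back to a fixed type, as the induction over \<open>\<T>_nat\<close> requires.\<close>

lemma rooted_tree_transport:
  assumes t: "rooted_tree t" and h: "inj_on h (verts t)"
  defines "t' \<equiv> RTree (h ` verts t) (\<lambda>y. h (par t (inv_into (verts t) h y))) (h (root t))"
  shows "rooted_tree t'" "tree_aut t \<cong> tree_aut t'" "card (verts t') = card (verts t)"
proof -
  obtain d :: "'a \<Rightarrow> nat" where d: "\<And>v. \<lbrakk>v \<in> verts t; v \<noteq> root t\<rbrakk> \<Longrightarrow> d (par t v) < d v"
    using rooted_tree_depth[OF t] by blast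
  note D = rooted_treeD[OF t]
  show "rooted_tree t'"
    unfolding rooted_tree_def
    by (intro conjI exI[of _ "d \<circ> inv_into (verts t) h"])
      (use D(1,2,4) h d in \<open>auto simp: t'_def inv_into_f_f D(3)\<close>)
  show "card (verts t') = card (verts t)"
    using h by (simp add: t'_def card_image)
  have bij: "bij_betw h (verts t) (h ` verts t)"
    using h by (rule inj_on_imp_bij_betw)
  show "tree_aut t \<cong> tree_aut t'"
    unfolding tree_aut_def t'_def rtree.sel
  proof (rule compose_in_Bij_iso[OF bij])
    fix f assume f: "f \<in> Bij (verts t)"
    let ?k = "inv_into (verts t) h"
    let ?F = "\<lambda>y\<in>h ` verts t. h (f (?k y))"
    have mem: "f x \<in> verts t" if "x \<in> verts t" for x
      using that f by (auto simp: Bij_def bij_betw_def)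
    have "bij_betw (h \<circ> (f \<circ> ?k)) (h ` verts t) (h ` verts t)"
      using f bij bij_betw_inv_into[OF bij] by (auto simp: Bij_def intro!: bij_betw_trans)
    then have "bij_betw ?F (h ` verts t) (h ` verts t)"
      by (rule bij_betw_cong[THEN iffD1, rotated]) simp
    then have FB: "?F \<in> Bij (h ` verts t)"
      by (simp add: Bij_def)
    have "?F (h (par t (?k (h x)))) = h (par t (?k (?F (h x)))) \<longleftrightarrow> f (par t x) = par t (f x)"
      if "x \<in> verts t" for x
      using that h mem D by (simp add: inv_into_f_f inj_on_eq_iff[OF h])
    then show "f \<in> {f \<in> Bij (verts t). \<forall>v\<in>verts t. f (par t v) = par t (f v)}
      \<longleftrightarrow> ?F \<in> {f \<in> Bij (h ` verts t). \<forall>v\<in>h ` verts t.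
            f (h (par t (?k v))) = h (par t (?k (f v)))}"
      using f FB by auto
  qed auto
qed


section \<open>Families of rooted trees\<close>

definition fverts :: "'x set \<Rightarrow> ('x \<Rightarrow> 'v rtree) \<Rightarrow> ('x \<times> 'v) set"
  where "fverts \<Omega> T = Sigma \<Omega> (\<lambda>x. verts (T x))"

definition fpar :: "('x \<Rightarrow> 'v rtree) \<Rightarrow> 'x \<times> 'v \<Rightarrow> 'x \<times> 'v"
  where "fpar T = (\<lambda>(x, v). (x, par (T x) v))"

definition froot :: "('x \<Rightarrow> 'v rtree) \<Rightarrow> 'x \<Rightarrow> 'x \<times> 'v"
  where "froot T x = (x, root (T x))"

lemma forest_depth:
  assumes "\<And>x. x \<in> \<Omega> \<Longrightarrow> rooted_tree (T x)"
  obtains d :: "'x \<times> 'v \<Rightarrow> nat"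
  where "\<And>s. \<lbrakk>s \<in> fverts \<Omega> T; fpar T s \<noteq> s\<rbrakk> \<Longrightarrow> d (fpar T s) < d s"
proof -
  have "\<forall>x\<in>\<Omega>. \<exists>d :: _ \<Rightarrow> nat. \<forall>v\<in>verts (T x). v \<noteq> root (T x) \<longrightarrow> d (par (T x) v) < d v"
    using assms by (meson rooted_tree_depth)
  from bchoice[OF this] obtain d :: "'x \<Rightarrow> 'v \<Rightarrow> nat" where
    "\<forall>x\<in>\<Omega>. \<forall>v\<in>verts (T x). v \<noteq> root (T x) \<longrightarrow> d x (par (T x) v) < d x v"
    by blast
  then show thesis
    by (intro that[of "\<lambda>(x, v). d x v"])
      (use rooted_treeD(5)[OF assms] in \<open>auto simp: fverts_def fpar_def\<close>)
qed

text \<open>The relation \<open>Q\<close> restricts how the trees may be permuted. If it is always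
  true, these are all automorphisms of the forest; if it is adjacency in a core, they turn out to be
  the graph automorphisms of the core with the trees attached.\<close>

definition forest_aut ::
  "'x set \<Rightarrow> ('x \<Rightarrow> 'v rtree) \<Rightarrow> ('x \<Rightarrow> 'x \<Rightarrow> bool) \<Rightarrow> ('x \<times> 'v \<Rightarrow> 'x \<times> 'v) monoid"
  where "forest_aut \<Omega> T Q = (BijGroup (fverts \<Omega> T))
    \<lparr>carrier := {f \<in> Bij (fverts \<Omega> T). (\<forall>s\<in>fverts \<Omega> T. f (fpar T s) = fpar T (f s)) \<and>
      (\<forall>x\<in>\<Omega>. \<forall>y\<in>\<Omega>. Q (fst (f (froot T x))) (fst (f (froot T y))) \<longleftrightarrow> Q x y)}\<rparr>"

text \<open>An automorphism of a forest permutes the trees by some \<open>\<sigma>\<close> and then acts on each tree. If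
  isomorphic trees of the family are equal, it is given by \<open>\<sigma>\<close> and one automorphism of each tree.\<close>

lemma forest_aut_decompose:
  assumes fin: "finite \<Omega>" and tree: "\<And>x. x \<in> \<Omega> \<Longrightarrow> rooted_tree (T x)"
    and col: "\<And>x y. \<lbrakk>x \<in> \<Omega>; y \<in> \<Omega>; card (verts (T x)) = card (verts (T y))\<rbrakk> \<Longrightarrow> T x = T y"
    and f: "f \<in> carrier (forest_aut \<Omega> T Q)"
  obtains \<sigma> g where "bij_betw \<sigma> \<Omega> \<Omega>" "\<And>x. x \<in> \<Omega> \<Longrightarrow> T (\<sigma> x) = T x"
    "\<And>x y. \<lbrakk>x \<in> \<Omega>; y \<in> \<Omega>\<rbrakk> \<Longrightarrow> Q (\<sigma> x) (\<sigma> y) \<longleftrightarrow> Q x y"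
    "\<And>x. x \<in> \<Omega> \<Longrightarrow> g x \<in> carrier (tree_aut (T x))"
    "\<And>x v. \<lbrakk>x \<in> \<Omega>; v \<in> verts (T x)\<rbrakk> \<Longrightarrow> f (x, v) = (\<sigma> x, g x v)"
proof -
  let ?S = "fverts \<Omega> T"
  have bij: "bij_betw f ?S ?S"
    and comm: "\<And>x v. \<lbrakk>x \<in> \<Omega>; v \<in> verts (T x)\<rbrakk> \<Longrightarrow> f (x, par (T x) v) = fpar T (f (x, v))"
    and Q: "\<And>x y. \<lbrakk>x \<in> \<Omega>; y \<in> \<Omega>\<rbrakk> \<Longrightarrow> Q (fst (f (froot T x))) (fst (f (froot T y))) \<longleftrightarrow> Q x y"
    using f by (auto simp: forest_aut_def Bij_def fverts_def fpar_def)
  note D = rooted_treeD[OF tree]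
  define \<sigma> where "\<sigma> x = fst (f (froot T x))" for x
  define g where "g x = (\<lambda>v\<in>verts (T x). snd (f (x, v)))" for x
  \<comment> \<open>Passing to the parent leaves the index unchanged on both sides of
    \<open>comm\<close>, so by induction from the root a whole tree is sent into a single
    tree.\<close>
  have "fst (f (x, v)) = \<sigma> x" if "x \<in> \<Omega>" "v \<in> verts (T x)" for x v
    using tree[OF that(1)] that(2)
  proof (induction rule: rooted_tree_induct)
    case (par v)
    then show ?case using comm[of x v] that(1) by (simp add: fpar_def case_prod_beta)
  qed (simp add: \<sigma>_def froot_def)
  then have feq: "f (x, v) = (\<sigma> x, g x v)" if "x \<in> \<Omega>" "v \<in> verts (T x)" for x v
    using that by (simp add: g_def prod_eq_iff)
  have mem: "\<sigma> x \<in> \<Omega>" "g x v \<in> verts (T (\<sigma> x))" if "x \<in> \<Omega>" "v \<in> verts (T x)" for x v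
    using bij_betw_apply[OF bij, of "(x, v)"] that feq[OF that] by (auto simp: fverts_def)
  have "\<sigma> ` \<Omega> = \<Omega>"
  proof
    show "\<sigma> ` \<Omega> \<subseteq> \<Omega>" using mem D(2) by blast
    show "\<Omega> \<subseteq> \<sigma> ` \<Omega>"
    proof
      fix y assume "y \<in> \<Omega>"
      then have "(y, root (T y)) \<in> f ` ?S" using bij D(2) by (auto simp: bij_betw_def fverts_def)
      then obtain x v where "x \<in> \<Omega>" "v \<in> verts (T x)" "f (x, v) = (y, root (T y))"
        by (auto simp: fverts_def)
      then show "y \<in> \<sigma> ` \<Omega>" using feq by fastforce
    qed
  qed
  then have \<sigma>: "bij_betw \<sigma> \<Omega> \<Omega>"
    using fin by (simp add: bij_betw_def finite_surj_inj)
  have gbij: "bij_betw (g x) (verts (T x)) (verts (T (\<sigma> x)))" if x: "x \<in> \<Omega>" for x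
    unfolding bij_betw_def
  proof
    show "inj_on (g x) (verts (T x))"
    proof (rule inj_onI)
      fix v w assume "v \<in> verts (T x)" "w \<in> verts (T x)" "g x v = g x w"
      then have "f (x, v) = f (x, w)" "(x, v) \<in> ?S" "(x, w) \<in> ?S"
        using x feq by (auto simp: fverts_def)
      then show "v = w" using bij by (auto simp: bij_betw_def inj_on_def)
    qed
    show "g x ` verts (T x) = verts (T (\<sigma> x))"
    proof
      show "g x ` verts (T x) \<subseteq> verts (T (\<sigma> x))" using mem x by blast
      show "verts (T (\<sigma> x)) \<subseteq> g x ` verts (T x)"
      proof
        fix w assume "w \<in> verts (T (\<sigma> x))"
        then have "(\<sigma> x, w) \<in> f ` ?S"
          using bij x bij_betw_apply[OF \<sigma>] by (auto simp: bij_betw_def fverts_def)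
        then obtain x' v where *: "x' \<in> \<Omega>" "v \<in> verts (T x')" "f (x', v) = (\<sigma> x, w)"
          by (auto simp: fverts_def)
        then have "\<sigma> x' = \<sigma> x" "g x' v = w" using feq by auto
        moreover from this have "x' = x" using \<sigma> x * by (auto simp: bij_betw_def inj_on_def)
        ultimately show "w \<in> g x ` verts (T x)" using * by blast
      qed
    qed
  qed
  \<comment> \<open>The bijection \<open>g x\<close> shows that the two trees have equal size, and
    then \<open>col\<close> makes them equal. Thus \<open>g x\<close> becomes a self-map of one
    tree.\<close>
  have T: "T (\<sigma> x) = T x" if "x \<in> \<Omega>" for x
    using col[of "\<sigma> x" x] bij_betw_same_card[OF gbij[OF that]] that bij_betw_apply[OF \<sigma> that] by simp
  have "g x (par (T x) v) = par (T x) (g x v)" if "x \<in> \<Omega>" "v \<in> verts (T x)" for x v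
    using comm[OF that] feq that D(4) T by (auto simp: fpar_def)
  then have "g x \<in> carrier (tree_aut (T x))" if "x \<in> \<Omega>" for x
    using gbij[OF that] T that by (simp add: tree_aut_def Bij_def g_def)
  then show thesis
    using that[of \<sigma> g] \<sigma> T feq Q by (simp add: \<sigma>_def)
qed

text \<open>The equations for \<open>act\<close> and \<open>\<gamma>\<close> of a product say that \<open>(act m, \<gamma> m)\<close> multiply as in a
  wreath product, with a base group that depends on the point.\<close>

lemma iso_forest_aut:
  assumes fin: "finite \<Omega>" and tree: "\<And>x. x \<in> \<Omega> \<Longrightarrow> rooted_tree (T x)"
    and col: "\<And>x y. \<lbrakk>x \<in> \<Omega>; y \<in> \<Omega>; card (verts (T x)) = card (verts (T y))\<rbrakk> \<Longrightarrow> T x = T y"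
    and act: "\<And>m. m \<in> carrier M \<Longrightarrow> bij_betw (act m) \<Omega> \<Omega>"
    and actT: "\<And>m x. \<lbrakk>m \<in> carrier M; x \<in> \<Omega>\<rbrakk> \<Longrightarrow> T (act m x) = T x"
    and actQ: "\<And>m x y. \<lbrakk>m \<in> carrier M; x \<in> \<Omega>; y \<in> \<Omega>\<rbrakk> \<Longrightarrow> Q (act m x) (act m y) \<longleftrightarrow> Q x y"
    and \<gamma>: "\<And>m x. \<lbrakk>m \<in> carrier M; x \<in> \<Omega>\<rbrakk> \<Longrightarrow> \<gamma> m x \<in> carrier (tree_aut (T x))"
    and act_mult: "\<And>m m' x. \<lbrakk>m \<in> carrier M; m' \<in> carrier M; x \<in> \<Omega>\<rbrakk>
      \<Longrightarrow> act (m \<otimes>\<^bsub>M\<^esub> m') x = act m (act m' x)"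
    and \<gamma>_mult: "\<And>m m' x. \<lbrakk>m \<in> carrier M; m' \<in> carrier M; x \<in> \<Omega>\<rbrakk>
      \<Longrightarrow> \<gamma> (m \<otimes>\<^bsub>M\<^esub> m') x = \<gamma> m (act m' x) \<otimes>\<^bsub>tree_aut (T x)\<^esub> \<gamma> m' x"
    and inj: "\<And>m m'. \<lbrakk>m \<in> carrier M; m' \<in> carrier M; \<And>x. x \<in> \<Omega> \<Longrightarrow> act m x = act m' x;
      \<And>x. x \<in> \<Omega> \<Longrightarrow> \<gamma> m x = \<gamma> m' x\<rbrakk> \<Longrightarrow> m = m'"
    and surj: "\<And>\<sigma> g. \<lbrakk>bij_betw \<sigma> \<Omega> \<Omega>; \<And>x. x \<in> \<Omega> \<Longrightarrow> T (\<sigma> x) = T x;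
      \<And>x y. \<lbrakk>x \<in> \<Omega>; y \<in> \<Omega>\<rbrakk> \<Longrightarrow> Q (\<sigma> x) (\<sigma> y) \<longleftrightarrow> Q x y;
      \<And>x. x \<in> \<Omega> \<Longrightarrow> g x \<in> carrier (tree_aut (T x))\<rbrakk>
      \<Longrightarrow> \<exists>m\<in>carrier M. \<forall>x\<in>\<Omega>. act m x = \<sigma> x \<and> \<gamma> m x = g x"
  shows "M \<cong> forest_aut \<Omega> T Q"
proof -
  let ?S = "fverts \<Omega> T"
  note D = rooted_treeD[OF tree]
  define F where "F m = (\<lambda>s\<in>?S. (act m (fst s), \<gamma> m (fst s) (snd s)))" for m
  have F: "F m (x, v) = (act m x, \<gamma> m x v)" if "x \<in> \<Omega>" "v \<in> verts (T x)" for m x v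
    using that by (simp add: F_def fverts_def)
  have cl: "act m x \<in> \<Omega>" if "m \<in> carrier M" "x \<in> \<Omega>" for m x
    using act[OF that(1)] that(2) by (rule bij_betw_apply)
  have \<gamma>bij: "bij_betw (\<gamma> m x) (verts (T x)) (verts (T x))"
    and \<gamma>par: "\<And>v. v \<in> verts (T x) \<Longrightarrow> \<gamma> m x (par (T x) v) = par (T x) (\<gamma> m x v)"
    and \<gamma>ext: "\<gamma> m x \<in> extensional (verts (T x))"
    if "m \<in> carrier M" "x \<in> \<Omega>" for m x
    using \<gamma>[OF that] by (auto simp: tree_aut_def Bij_def)
  have \<gamma>cl: "\<gamma> m x v \<in> verts (T x)" if "m \<in> carrier M" "x \<in> \<Omega>" "v \<in> verts (T x)" for m x v
    using \<gamma>bij[OF that(1,2)] that(3) by (rule bij_betw_apply)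
  have FBij: "F m \<in> Bij ?S" if m: "m \<in> carrier M" for m
  proof -
    have "inj_on (F m) ?S"
    proof (rule inj_onI)
      fix s t assume "s \<in> ?S" "t \<in> ?S" "F m s = F m t"
      then show "s = t"
        using act[OF m] \<gamma>bij[OF m] by (auto simp: F_def fverts_def bij_betw_def inj_on_def)
    qed
    moreover have "F m ` ?S \<subseteq> ?S"
      using m cl \<gamma>cl actT by (auto simp: F_def fverts_def)
    moreover have "finite ?S"
      using fin D(1) by (simp add: fverts_def)
    ultimately have "bij_betw (F m) ?S ?S"
      by (simp add: bij_betw_def endo_inj_surj)
    then show ?thesis by (simp add: Bij_def F_def)
  qed
  have F_carrier: "F m \<in> carrier (forest_aut \<Omega> T Q)" if m: "m \<in> carrier M" for m
    using FBij[OF m] m \<gamma>par D(2,4) actT actQ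
    by (auto simp: forest_aut_def fpar_def froot_def F fverts_def)
  have "F (m \<otimes>\<^bsub>M\<^esub> m') = F m \<otimes>\<^bsub>forest_aut \<Omega> T Q\<^esub> F m'"
    if m: "m \<in> carrier M" "m' \<in> carrier M" for m m'
  proof -
    have "F (m \<otimes>\<^bsub>M\<^esub> m') = compose ?S (F m) (F m')"
    proof (rule extensionalityI[where A = ?S])
      fix s assume "s \<in> ?S"
      then obtain x v where s: "s = (x, v)" "x \<in> \<Omega>" "v \<in> verts (T x)" by (auto simp: fverts_def)
      have "\<gamma> m (act m' x) \<in> Bij (verts (T x))" "\<gamma> m' x \<in> Bij (verts (T x))"
        using \<gamma>[of m "act m' x"] \<gamma>[of m' x] m s cl actT by (auto simp: tree_aut_def)
      then show "F (m \<otimes>\<^bsub>M\<^esub> m') s = compose ?S (F m) (F m') s"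
        using s m cl \<gamma>cl actT \<open>s \<in> ?S\<close>
        by (simp add: F act_mult \<gamma>_mult compose_def tree_aut_def BijGroup_def)
    qed (auto simp: F_def)
    then show ?thesis
      using FBij m by (simp add: forest_aut_def BijGroup_def)
  qed
  then have "F \<in> hom M (forest_aut \<Omega> T Q)"
    using F_carrier by (auto simp: hom_def)
  moreover have "inj_on F (carrier M)"
  proof (rule inj_onI)
    fix m m' assume m: "m \<in> carrier M" "m' \<in> carrier M" "F m = F m'"
    have "act m x = act m' x \<and> \<gamma> m x v = \<gamma> m' x v" if "x \<in> \<Omega>" "v \<in> verts (T x)" for x v
      using F[OF that, of m] F[OF that, of m'] m(3) by simp
    then show "m = m'"
      using m \<gamma>ext D(2) by (intro inj) (blast intro: extensionalityI)+
  qed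
  moreover have "f \<in> F ` carrier M" if f: "f \<in> carrier (forest_aut \<Omega> T Q)" for f
  proof -
    obtain \<sigma> g where *: "bij_betw \<sigma> \<Omega> \<Omega>" "\<And>x. x \<in> \<Omega> \<Longrightarrow> T (\<sigma> x) = T x"
      "\<And>x y. \<lbrakk>x \<in> \<Omega>; y \<in> \<Omega>\<rbrakk> \<Longrightarrow> Q (\<sigma> x) (\<sigma> y) \<longleftrightarrow> Q x y"
      "\<And>x. x \<in> \<Omega> \<Longrightarrow> g x \<in> carrier (tree_aut (T x))"
      and feq: "\<And>x v. \<lbrakk>x \<in> \<Omega>; v \<in> verts (T x)\<rbrakk> \<Longrightarrow> f (x, v) = (\<sigma> x, g x v)"
      using forest_aut_decompose[OF fin tree col f] by blast
    obtain m where m: "m \<in> carrier M" "\<forall>x\<in>\<Omega>. act m x = \<sigma> x \<and> \<gamma> m x = g x"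
      using surj[OF *] by blast
    have "f = F m"
      by (rule extensionalityI[where A = ?S])
        (use f m feq F in \<open>auto simp: forest_aut_def Bij_def F_def fverts_def\<close>)
    then show ?thesis using m(1) by blast
  qed
  ultimately have "F \<in> iso M (forest_aut \<Omega> T Q)"
    using F_carrier by (auto simp: iso_def bij_betw_def)
  then show ?thesis by (rule is_isoI)
qed

section \<open>Joining a family of rooted trees to a new root\<close>

definition graft :: "'x set \<Rightarrow> ('x \<Rightarrow> 'v rtree) \<Rightarrow> ('x \<times> 'v) option rtree"
  where "graft \<Omega> T = RTree (insert None (Some ` fverts \<Omega> T))
    (\<lambda>s. case s of None \<Rightarrow> None
      | Some (x, v) \<Rightarrow> if v = root (T x) then None else Some (x, par (T x) v)) None"

text \<open>The new root \<open>None\<close> is the only fixed point of the parent map, so every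
  automorphism of the joined tree fixes it and restricts to the old vertices. There it commutes with
  the old parent maps, because the old roots are exactly the other vertices with parent
  \<open>None\<close>.\<close>

lemma graft:
  assumes fin: "finite \<Omega>" and tree: "\<And>x. x \<in> \<Omega> \<Longrightarrow> rooted_tree (T x)"
  shows "rooted_tree (graft \<Omega> T)"
    and "card (verts (graft \<Omega> T)) = Suc (\<Sum>x\<in>\<Omega>. card (verts (T x)))"
    and "forest_aut \<Omega> T (\<lambda>_ _. True) \<cong> tree_aut (graft \<Omega> T)"
proof -
  let ?S = "fverts \<Omega> T" and ?t = "graft \<Omega> T"
  let ?V = "verts ?t"
  note D = rooted_treeD[OF tree]
  have finS: "finite ?S" using fin D(1) by (simp add: fverts_def)
  from forest_depth[of \<Omega> T, OF tree] obtain d :: "'a \<times> 'b \<Rightarrow> nat" where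
    d: "\<And>s. \<lbrakk>s \<in> fverts \<Omega> T; fpar T s \<noteq> s\<rbrakk> \<Longrightarrow> d (fpar T s) < d s"
    by blast
  have d: "d (x, par (T x) v) < d (x, v)" if "x \<in> \<Omega>" "v \<in> verts (T x)" "v \<noteq> root (T x)" for x v
    using d[of "(x, v)"] that D(5)[OF that(1,2)] by (simp add: fverts_def fpar_def)
  \<comment> \<open>The new root gets rank 0 and all old ranks are raised by one, so that even old
    roots of rank 0 lie above it.\<close>
  show tree': "rooted_tree ?t"
    unfolding rooted_tree_def
    by (intro conjI exI[of _ "\<lambda>s. case s of None \<Rightarrow> 0 | Some s \<Rightarrow> Suc (d s)"])
      (use finS d D(4) in \<open>auto simp: graft_def fverts_def\<close>)
  show "card ?V = Suc (\<Sum>x\<in>\<Omega>. card (verts (T x)))"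
    using finS fin D(1) by (simp add: graft_def card_image fverts_def card_SigmaI)
  have V: "?V = insert None (Some ` ?S)" by (simp add: graft_def)
  have parN: "par ?t None = None" by (simp add: graft_def)
  have parS: "par ?t (Some s) = (if fpar T s = s then None else Some (fpar T s))" if "s \<in> ?S" for s
    using that D(5) by (auto simp: graft_def fpar_def fverts_def split: if_splits)
  have fparS: "fpar T s \<in> ?S" if "s \<in> ?S" for s
    using that D(4) by (auto simp: fpar_def fverts_def)
  define F where "F f = (\<lambda>s\<in>?V. map_option f s)" for f :: "'a \<times> 'b \<Rightarrow> 'a \<times> 'b"
  have FN: "F f None = None" and FS: "\<And>s. s \<in> ?S \<Longrightarrow> F f (Some s) = Some (f s)" for f
    by (auto simp: F_def V)
  have mem: "f x \<in> U" if "f \<in> Bij U" "x \<in> U" for f x and U :: "'c set"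
    using that by (auto simp: Bij_def bij_betw_def)
  have FBij: "F f \<in> Bij ?V" if f: "f \<in> Bij ?S" for f
  proof -
    have "inj_on (F f) ?V"
      using f by (auto simp: inj_on_def V FN FS Bij_def bij_betw_def)
    moreover have "F f ` ?V \<subseteq> ?V" using mem[OF f] by (auto simp: V FN FS)
    moreover have "finite ?V" using finS by (simp add: V)
    ultimately have "bij_betw (F f) ?V ?V"
      by (simp only: bij_betw_def endo_inj_surj)
    then show ?thesis by (simp add: Bij_def F_def)
  qed
  have F_carrier: "F f \<in> carrier (tree_aut ?t)" if f: "f \<in> carrier (forest_aut \<Omega> T (\<lambda>_ _. True))" for f
  proof -
    have fB: "f \<in> Bij ?S" and comm: "\<And>s. s \<in> ?S \<Longrightarrow> f (fpar T s) = fpar T (f s)"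
      using f by (auto simp: forest_aut_def)
    have "F f (par ?t s) = par ?t (F f s)" if s: "s \<in> ?V" for s
    proof (cases s)
      case (Some a)
      with s have a: "a \<in> ?S" by (auto simp: V)
      \<comment> \<open>Old roots, and only they, go to old roots, so \<open>parS\<close> is in the
        same case for \<open>a\<close> and for its image.\<close>
      have "fpar T (f a) = f a \<longleftrightarrow> fpar T a = a"
        using fB comm[OF a] a fparS[OF a] by (auto simp: Bij_def bij_betw_def inj_on_def)
      then show ?thesis
        using a mem[OF fB a] comm[OF a] fparS[OF a] by (simp add: Some parS FS FN)
    qed (simp add: FN parN)
    then show ?thesis using FBij[OF fB] by (simp add: tree_aut_def)
  qed
  have "F (compose ?S f g) = compose ?V (F f) (F g)" if "f \<in> Bij ?S" "g \<in> Bij ?S" for f g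
    by (rule extensionalityI[where A = ?V])
      (use mem[OF that(2)] in \<open>auto simp: FN FS V compose_def F_def\<close>)
  then have "F \<in> hom (forest_aut \<Omega> T (\<lambda>_ _. True)) (tree_aut ?t)"
    using F_carrier FBij by (auto simp: hom_def forest_aut_def tree_aut_def BijGroup_def)
  moreover have "inj_on F (carrier (forest_aut \<Omega> T (\<lambda>_ _. True)))"
  proof (rule inj_onI)
    fix f g assume *: "f \<in> carrier (forest_aut \<Omega> T (\<lambda>_ _. True))"
      "g \<in> carrier (forest_aut \<Omega> T (\<lambda>_ _. True))" "F f = F g"
    show "f = g"
    proof (rule extensionalityI[where A = ?S])
      fix s assume "s \<in> ?S"
      then show "f s = g s" using FS[of s f] FS[of s g] *(3) by simp
    qed (use * in \<open>auto simp: forest_aut_def Bij_def\<close>)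
  qed
  moreover have "f \<in> F ` carrier (forest_aut \<Omega> T (\<lambda>_ _. True))" if f: "f \<in> carrier (tree_aut ?t)" for f
  proof -
    have fB: "f \<in> Bij ?V" and comm: "\<And>s. s \<in> ?V \<Longrightarrow> f (par ?t s) = par ?t (f s)"
      using f by (auto simp: tree_aut_def)
    have "par ?t (f None) = f None"
      using comm[of None] by (simp add: parN V)
    then have fN: "f None = None"
      using rooted_treeD(5)[OF tree', of "f None"] mem[OF fB, of None] by (simp add: V graft_def)
    have fS: "f (Some s) \<in> Some ` ?S" if s: "s \<in> ?S" for s
    proof -
      have "f (Some s) \<noteq> f None"
        using fB s by (auto simp: Bij_def bij_betw_def inj_on_def V)
      then show ?thesis using mem[OF fB, of "Some s"] s fN by (auto simp: V)
    qed
    define g where "g = (\<lambda>s\<in>?S. the (f (Some s)))"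
    have gS: "f (Some s) = Some (g s)" "g s \<in> ?S" if "s \<in> ?S" for s
      using fS[OF that] that by (auto simp: g_def)
    have "inj_on g ?S"
    proof (rule inj_onI)
      fix s t assume *: "s \<in> ?S" "t \<in> ?S" "g s = g t"
      then have "f (Some s) = f (Some t)" by (simp add: gS)
      then show "s = t" using fB * by (auto simp: Bij_def bij_betw_def inj_on_def V)
    qed
    then have "g \<in> Bij ?S"
      using gS finS by (auto simp: Bij_def bij_betw_def g_def endo_inj_surj image_subset_iff)
    moreover have "g (fpar T s) = fpar T (g s)" if s: "s \<in> ?S" for s
      using comm[of "Some s"] s fparS[OF s] gS
      by (auto simp: V parS fN split: if_splits)
    moreover have "F g = f"
      by (rule extensionalityI[where A = ?V])
        (use fB fN gS in \<open>auto simp: V FN FS F_def Bij_def\<close>)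
    ultimately show ?thesis by (auto simp: forest_aut_def image_iff)
  qed
  ultimately have "F \<in> iso (forest_aut \<Omega> T (\<lambda>_ _. True)) (tree_aut ?t)"
    using F_carrier by (auto simp: iso_def bij_betw_def)
  then show "forest_aut \<Omega> T (\<lambda>_ _. True) \<cong> tree_aut ?t"
    by (rule is_isoI)
qed

lemma graft_nat:
  fixes T :: "'x :: countable \<Rightarrow> 'v :: countable rtree"
  assumes "finite \<Omega>" "\<And>x. x \<in> \<Omega> \<Longrightarrow> rooted_tree (T x)"
    and M: "M \<cong> forest_aut \<Omega> T (\<lambda>_ _. True)"
  obtains t :: "nat rtree" where "rooted_tree t" "M \<cong> tree_aut t"
    "card (verts t) = Suc (\<Sum>x\<in>\<Omega>. card (verts (T x)))"
proof -
  note * = graft[OF assms(1,2)]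
  have "inj_on to_nat (verts (graft \<Omega> T))" by simp
  note t = rooted_tree_transport[OF *(1) this]
  show thesis
    by (rule that[OF t(1) iso_trans[OF M iso_trans[OF *(3) t(2)]] trans[OF t(3) *(2)]])
qed


section \<open>Groups of rooted trees\<close>

lemma isoD:
  assumes i: "i \<in> iso M N"
  shows "\<And>m. m \<in> carrier M \<Longrightarrow> i m \<in> carrier N"
    "\<And>m m'. \<lbrakk>m \<in> carrier M; m' \<in> carrier M\<rbrakk> \<Longrightarrow> i (m \<otimes>\<^bsub>M\<^esub> m') = i m \<otimes>\<^bsub>N\<^esub> i m'"
    "\<And>m m'. \<lbrakk>m \<in> carrier M; m' \<in> carrier M; i m = i m'\<rbrakk> \<Longrightarrow> m = m'"
    "\<And>g. g \<in> carrier N \<Longrightarrow> \<exists>m\<in>carrier M. i m = g"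
proof -
  show "\<exists>m\<in>carrier M. i m = g" if "g \<in> carrier N" for g
  proof -
    have "g \<in> i ` carrier M" using i that by (simp add: iso_def bij_betw_def)
    then show ?thesis by blast
  qed
qed (use i in \<open>auto simp: iso_def hom_def bij_betw_def inj_on_def\<close>)

lemma tree_with_card:
  fixes t :: "nat rtree"
  assumes "rooted_tree t" "M \<cong> tree_aut t" "card (verts t) \<le> n"
  shows "\<exists>t' :: nat rtree. rooted_tree t' \<and> M \<cong> tree_aut t' \<and> card (verts t') = n"
  using assms(3)
proof (induction rule: dec_induct)
  case (step n)
  then obtain t' :: "nat rtree" where t': "rooted_tree t'" "M \<cong> tree_aut t'" "card (verts t') = n"
    by blast
  from t'(2) obtain i where "i \<in> iso M (tree_aut t')" by (auto simp: is_iso_def)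
  note i = isoD[OF this]
  have "M \<cong> forest_aut {()} (\<lambda>_. t') (\<lambda>_ _. True)"
  proof (rule iso_forest_aut[where act = "\<lambda>_ x. x" and \<gamma> = "\<lambda>m _. i m"], goal_cases)
    case (10 m m')
    then show ?case using i(3) by blast
  next
    case (11 \<sigma> g)
    then show ?case using i(4) by auto
  qed (use t' i(1,2) in \<open>auto simp: bij_betw_def\<close>)
  from graft_nat[OF _ _ this] t' show ?case by auto
qed (use assms in blast)

lemma \<T>_nat_tree:
  assumes "G \<in> \<T>_nat"
  shows "\<exists>t :: nat rtree. rooted_tree t \<and> G \<cong> tree_aut t"
  using assms
proof (induction rule: \<T>_nat.induct)
  case (trivial G)
  let ?t = "RTree {0 :: nat} id 0"
  define e where "e = (\<lambda>x\<in>{0 :: nat}. 0 :: nat)"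
  have e: "e \<in> Bij {0}"
    by (simp add: e_def Bij_def bij_betw_def)
  have "f = e" if "f \<in> Bij {0}" for f
    by (rule extensionalityI[where A = "{0}"]) (use that in \<open>auto simp: e_def Bij_def bij_betw_def\<close>)
  with e have "Bij {0} = {e}" by blast
  then have car: "carrier (tree_aut ?t) = {e}"
    by (auto simp: tree_aut_def)
  have "compose {0} e e = e"
    by (rule extensionalityI[where A = "{0}"]) (simp_all add: e_def compose_def)
  with e have "e \<otimes>\<^bsub>tree_aut ?t\<^esub> e = e"
    by (simp add: tree_aut_def BijGroup_def)
  with car trivial have "(\<lambda>_. e) \<in> iso G (tree_aut ?t)"
    by (simp add: iso_def hom_def bij_betw_def)
  then have "G \<cong> tree_aut ?t" by (rule is_isoI)
  moreover have "rooted_tree ?t" by (simp add: rooted_tree_def)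
  ultimately show ?case by blast
next
  case (prod G1 G2 G)
  then obtain s1 t2 :: "nat rtree" where s1: "rooted_tree s1" "G1 \<cong> tree_aut s1"
    and t2: "rooted_tree t2" "G2 \<cong> tree_aut t2" by blast
  \<comment> \<open>The size has to be at least that of \<open>s1\<close>, to be reachable by
    enlarging, and different from that of \<open>t2\<close>, so that the two trees cannot be
    exchanged. One more than the sum satisfies both.\<close>
  obtain t1 :: "nat rtree" where t1: "rooted_tree t1" "G1 \<cong> tree_aut t1"
    and card: "card (verts t1) = Suc (card (verts s1) + card (verts t2))"
    using tree_with_card[OF s1, of "Suc (card (verts s1) + card (verts t2))"] by auto
  from t1(2) obtain i where "i \<in> iso G1 (tree_aut t1)" by (auto simp: is_iso_def)
  note i = isoD[OF this]
  from t2(2) obtain j where "j \<in> iso G2 (tree_aut t2)" by (auto simp: is_iso_def)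
  note j = isoD[OF this]
  have ne: "t1 \<noteq> t2" using card by auto
  let ?\<Omega> = "{False, True}" and ?T = "\<lambda>b. if b then t1 else t2"
  have "G1 \<times>\<times> G2 \<cong> forest_aut ?\<Omega> ?T (\<lambda>_ _. True)"
  proof (rule iso_forest_aut[where act = "\<lambda>_ x. x" and \<gamma> = "\<lambda>m b. if b then i (fst m) else j (snd m)"],
      goal_cases)
    case (11 \<sigma> g)
    obtain a b where "a \<in> carrier G1" "i a = g True" "b \<in> carrier G2" "j b = g False"
      using i(4)[of "g True"] j(4)[of "g False"] 11(4)[of True] 11(4)[of False] by auto
    moreover have "\<sigma> x = x" for x
      using 11(2)[of x] ne by (cases x) (auto split: if_splits)
    ultimately show ?case by (intro bexI[of _ "(a, b)"]) auto
  next
    case (10 m m')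
    from 10(4)[of True] 10(4)[of False] 10(1,2) show ?case by (auto dest: i(3) j(3))
  next
    case (3 x y)
    then show ?case by (auto simp: card split: if_splits)
  qed (use t1(1) t2(1) in \<open>auto simp: i(1,2) j(1,2) bij_betw_def\<close>)
  then have "G \<cong> forest_aut ?\<Omega> ?T (\<lambda>_ _. True)" using prod.hyps iso_trans by blast
  then show ?case
    by (rule graft_nat[rotated 2]) (use t1(1) t2(1) in auto)
next
  case (wreath G1 n G)
  then obtain t :: "nat rtree" where t: "rooted_tree t" "G1 \<cong> tree_aut t" by blast
  from t(2) obtain i where "i \<in> iso G1 (tree_aut t)" by (auto simp: is_iso_def)
  note i = isoD[OF this]
  let ?\<Omega> = "{1..n}"
  have car: "carrier (wreath_sym G1 n) = {p. p permutes ?\<Omega>} \<times> (?\<Omega> \<rightarrow>\<^sub>E carrier G1)"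
    and mul: "(p, f) \<otimes>\<^bsub>wreath_sym G1 n\<^esub> (q, g) = (p \<circ> q, \<lambda>x\<in>?\<Omega>. f (q x) \<otimes>\<^bsub>G1\<^esub> g x)" for p q f g
    by (auto simp: wreath_sym_def wreath_def sym_group_def)
  \<comment> \<open>All trees are equal, so every permutation of the indices is admissible. The
    product in \<open>wreath_sym\<close> evaluates the first function at points moved by the second
    permutation, just as composition of forest automorphisms does.\<close>
  have "wreath_sym G1 n \<cong> forest_aut ?\<Omega> (\<lambda>_. t) (\<lambda>_ _. True)"
  proof (rule iso_forest_aut[where act = fst and \<gamma> = "\<lambda>m x. i (snd m x)"], goal_cases)
    case (4 m)
    then show ?case using car permutes_imp_bij by auto
  next
    case (7 m x)
    then have "snd m \<in> ?\<Omega> \<rightarrow>\<^sub>E carrier G1" by (auto simp: car)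
    from PiE_mem[OF this 7(2)] show ?case by (rule i(1))
  next
    case (8 m m' x)
    then show ?case by (cases m; cases m') (simp add: mul)
  next
    case (9 m m' x)
    then obtain p f q g where *: "m = (p, f)" "m' = (q, g)" "q permutes ?\<Omega>"
      "f \<in> ?\<Omega> \<rightarrow>\<^sub>E carrier G1" "g \<in> ?\<Omega> \<rightarrow>\<^sub>E carrier G1" by (auto simp: car)
    have "q x \<in> ?\<Omega>" using permutes_in_image[OF *(3), of x] 9(3) by blast
    with * have "f (q x) \<in> carrier G1" "g x \<in> carrier G1"
      using * 9(3) by (blast dest: PiE_mem)+
    then show ?case using 9(3) i(2) by (simp add: * mul)
  next
    case (10 m m')
    then obtain p f q g where *: "m = (p, f)" "m' = (q, g)" "p permutes ?\<Omega>" "q permutes ?\<Omega>"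
      "f \<in> ?\<Omega> \<rightarrow>\<^sub>E carrier G1" "g \<in> ?\<Omega> \<rightarrow>\<^sub>E carrier G1" by (auto simp: car)
    have "p x = q x" for x
      using 10(3)[of x] * by (cases "x \<in> ?\<Omega>") (simp_all add: permutes_not_in)
    moreover have "f x = g x" if "x \<in> ?\<Omega>" for x
      using 10(4)[OF that] i(3)[of "f x" "g x"] PiE_mem[OF *(5) that] PiE_mem[OF *(6) that] *(1,2) by simp
    then have "f = g" using * by (blast intro: PiE_ext)
    ultimately show ?case using * by auto
  next
    case (11 \<sigma> g)
    from 11(4) i(4) have "\<forall>x\<in>?\<Omega>. \<exists>m. m \<in> carrier G1 \<and> i m = g x" by blast
    from bchoice[OF this] obtain f where f: "\<forall>x\<in>?\<Omega>. f x \<in> carrier G1 \<and> i (f x) = g x" by blast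
    \<comment> \<open>\<open>\<sigma>\<close> is controlled on the index set only, whereas elements
      of \<open>sym_group\<close> are the identity elsewhere.\<close>
    define p where "p x = (if x \<in> ?\<Omega> then \<sigma> x else x)" for x
    have "bij_betw p ?\<Omega> ?\<Omega>"
      using 11(1) by (rule bij_betw_cong[THEN iffD1, rotated]) (simp add: p_def)
    then have "p permutes ?\<Omega>"
      by (rule bij_imp_permutes) (auto simp: p_def)
    then have "(p, restrict f ?\<Omega>) \<in> carrier (wreath_sym G1 n)" using f by (auto simp: car)
    then show ?case using f by (intro bexI[of _ "(p, restrict f ?\<Omega>)"]) (auto simp: p_def)
  qed (use t in auto)
  then have "G \<cong> forest_aut ?\<Omega> (\<lambda>_. t) (\<lambda>_ _. True)" using wreath.hyps iso_trans by blast
  then show ?case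
    by (rule graft_nat[rotated 2]) (use t(1) in auto)
qed


section \<open>Rooted trees attached to the vertices of a graph\<close>

definition attach_edges :: "'x set \<Rightarrow> ('x \<Rightarrow> 'x \<Rightarrow> bool) \<Rightarrow> ('x \<Rightarrow> 'v rtree) \<Rightarrow> ('x \<times> 'v) set set"
  where "attach_edges \<Omega> Q T = {{froot T x, froot T y} | x y. x \<in> \<Omega> \<and> y \<in> \<Omega> \<and> Q x y} \<union>
    {{s, fpar T s} | s. s \<in> fverts \<Omega> T \<and> fpar T s \<noteq> s}"

text \<open>The assumption \<open>degree\<close> makes the core recoverable from the graph: no core
  vertex ever becomes a leaf, however many tree vertices have been removed.\<close>

locale attached_trees =
  fixes \<Omega> :: "'x set" and Q :: "'x \<Rightarrow> 'x \<Rightarrow> bool" and T :: "'x \<Rightarrow> 'v rtree"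
  assumes fin: "finite \<Omega>" and tree: "\<And>x. x \<in> \<Omega> \<Longrightarrow> rooted_tree (T x)"
    and Q_sym: "\<And>x y. Q x y \<Longrightarrow> Q y x" and Q_irrefl: "\<And>x. \<not> Q x x"
    and degree: "\<And>x. x \<in> \<Omega> \<Longrightarrow> \<exists>y\<in>\<Omega>. \<exists>z\<in>\<Omega>. y \<noteq> z \<and> Q x y \<and> Q x z"
begin

abbreviation "S \<equiv> fverts \<Omega> T"
abbreviation "P \<equiv> fpar T"
abbreviation "E \<equiv> attach_edges \<Omega> Q T"
abbreviation "R \<equiv> froot T ` \<Omega>"

lemmas D = rooted_treeD[OF tree]

lemma finite_S: "finite S"
  using fin D(1) by (simp add: fverts_def)

lemma R_subset: "R \<subseteq> S"
  using D(2) by (auto simp: fverts_def froot_def)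

lemma P_closed: "s \<in> S \<Longrightarrow> P s \<in> S"
  using D(4) by (auto simp: fverts_def fpar_def)

lemma P_fixed: "s \<in> S \<Longrightarrow> P s = s \<longleftrightarrow> s \<in> R"
  using D(5) by (auto simp: fverts_def fpar_def froot_def)

lemma fst_froot [simp]: "fst (froot T x) = x"
  by (simp add: froot_def)

lemma froot_eq_iff [simp]: "froot T x = froot T y \<longleftrightarrow> x = y"
  by (auto simp: froot_def)

lemma edge_iff:
  assumes "s \<in> S" "t \<in> S"
  shows "{s, t} \<in> E \<longleftrightarrow>
    s \<in> R \<and> t \<in> R \<and> Q (fst s) (fst t) \<or> s \<noteq> t \<and> (P s = t \<or> P t = s)"
proof -
  have "{s, t} \<in> {{froot T x, froot T y} | x y. x \<in> \<Omega> \<and> y \<in> \<Omega> \<and> Q x y}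
      \<longleftrightarrow> s \<in> R \<and> t \<in> R \<and> Q (fst s) (fst t)"
    using Q_sym by (auto simp: doubleton_eq_iff; blast)
  moreover have "{s, t} \<in> {{s, P s} | s. s \<in> S \<and> P s \<noteq> s} \<longleftrightarrow> s \<noteq> t \<and> (P s = t \<or> P t = s)"
    using assms by (simp add: doubleton_eq_iff del: split_paired_Ex) metis
  ultimately show ?thesis unfolding attach_edges_def by blast
qed

text \<open>The core consists of the vertices that survive the repeated removal of leaves.\<close>

lemma subset_core:
  assumes W: "W \<subseteq> S"
    and deg: "\<And>w. w \<in> W \<Longrightarrow> \<exists>s\<in>W. \<exists>t\<in>W. s \<noteq> t \<and> {w, s} \<in> E \<and> {w, t} \<in> E"
  shows "W \<subseteq> R"
proof (rule ccontr)
  obtain d where d: "\<And>s. \<lbrakk>s \<in> S; P s \<noteq> s\<rbrakk> \<Longrightarrow> (d (P s) :: nat) < d s"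
    using forest_depth[of \<Omega> T, OF tree] by blast
  assume "\<not> W \<subseteq> R"
  moreover have "finite (W - R)" using W finite_S by (blast intro: finite_subset)
  ultimately have "finite (d ` (W - R))" "d ` (W - R) \<noteq> {}" by auto
  \<comment> \<open>A vertex of maximal rank among those of \<open>W\<close> outside the core has no
    child in \<open>W\<close>. Its parent is then its only possible neighbour in \<open>W\<close>,
    against \<open>deg\<close>.\<close>
  from Max_in[OF this] obtain w where w: "w \<in> W" "w \<notin> R" "d w = Max (d ` (W - R))" by auto
  have "u = P w" if u: "u \<in> W" "{w, u} \<in> E" for u
  proof (rule ccontr)
    assume "u \<noteq> P w"
    with u w W have *: "P u = w" "w \<noteq> u" using edge_iff[of w u] by auto
    then have "u \<notin> R" using P_fixed[of u] u W by auto
    then have "d u \<le> d w"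
      using u(1) w(3) \<open>finite (d ` (W - R))\<close> by simp
    then show False using d[of u] * u W by auto
  qed
  then show False using deg[OF w(1)] by blast
qed

text \<open>Every core vertex has two neighbours in the core, and an automorphism passes this
  property on to the image of the core. By \<open>subset_core\<close> the image lies in the core,
  and the cardinalities agree.\<close>

lemma Aut_image_core:
  assumes "f \<in> carrier (Aut S E)"
  shows "f ` R = R"
proof (rule card_subset_eq)
  have bij: "bij_betw f S S" and fE: "\<And>u v. \<lbrakk>u \<in> S; v \<in> S\<rbrakk> \<Longrightarrow> {f u, f v} \<in> E \<longleftrightarrow> {u, v} \<in> E"
    using assms by (auto simp: Aut_def Bij_def)
  show "finite R" using fin by simp
  show "f ` R \<subseteq> R"
  proof (rule subset_core)
    show "f ` R \<subseteq> S" using bij R_subset by (auto simp: bij_betw_def)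
    fix w assume "w \<in> f ` R"
    then obtain x where x: "x \<in> \<Omega>" "w = f (froot T x)" by auto
    obtain y z where yz: "y \<in> \<Omega>" "z \<in> \<Omega>" "y \<noteq> z" "Q x y" "Q x z"
      using degree[OF x(1)] by blast
    have S: "froot T u \<in> S" if "u \<in> \<Omega>" for u using that R_subset by blast
    have "f (froot T y) \<noteq> f (froot T z)"
      using bij S[OF yz(1)] S[OF yz(2)] yz(3) by (auto simp: bij_betw_def inj_on_def froot_def)
    moreover have "{w, f (froot T y)} \<in> E" "{w, f (froot T z)} \<in> E"
      using x yz S by (auto simp: fE edge_iff)
    ultimately show "\<exists>s\<in>f ` R. \<exists>t\<in>f ` R. s \<noteq> t \<and> {w, s} \<in> E \<and> {w, t} \<in> E"
      using yz by blast
  qed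
  show "card (f ` R) = card R"
    using bij R_subset by (auto intro!: card_image simp: bij_betw_def intro: inj_on_subset)
qed

text \<open>Graph automorphisms know nothing of parents, but they preserve the core, and directing
  every tree edge towards the core recovers the parent map. Both groups consist of bijections of the
  same set under composition, so comparing carriers suffices.\<close>

lemma Aut_eq_forest_aut: "Aut S E = forest_aut \<Omega> T Q"
proof -
  have "f \<in> carrier (Aut S E) \<longleftrightarrow> f \<in> carrier (forest_aut \<Omega> T Q)" for f
  proof
    assume f: "f \<in> carrier (Aut S E)"
    then have fB: "f \<in> Bij S" and bij: "bij_betw f S S"
      and fE: "\<And>u v. \<lbrakk>u \<in> S; v \<in> S\<rbrakk> \<Longrightarrow> {f u, f v} \<in> E \<longleftrightarrow> {u, v} \<in> E"
      by (auto simp: Aut_def Bij_def)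
    have mem: "f s \<in> S" if "s \<in> S" for s using bij that by (rule bij_betw_apply)
    have inj: "f s = f t \<longleftrightarrow> s = t" if "s \<in> S" "t \<in> S" for s t
      using bij that by (auto simp: bij_betw_def inj_on_def)
    have core: "f s \<in> R \<longleftrightarrow> s \<in> R" if "s \<in> S" for s
    proof
      assume "f s \<in> R"
      then have "f s \<in> f ` R" by (simp only: Aut_image_core[OF f])
      then obtain r where "r \<in> R" "f s = f r" by blast
      then show "s \<in> R" using inj[OF that, of r] R_subset by blast
    qed (use Aut_image_core[OF f] in blast)
    obtain d where d: "\<And>s. \<lbrakk>s \<in> S; P s \<noteq> s\<rbrakk> \<Longrightarrow> (d (P s) :: nat) < d s"
      using forest_depth[of \<Omega> T, OF tree] by blast
    have comm: "f (P s) = P (f s)" if "s \<in> S" for s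
      using that
    proof (induction "d s" arbitrary: s rule: less_induct)
      case less
      show ?case
      proof (cases "s \<in> R")
        case True
        then have "P s = s" "P (f s) = f s"
          using P_fixed core mem less(2) by blast+
        then show ?thesis by simp
      next
        case False
        then have ne: "P s \<noteq> s" and fs: "f s \<notin> R" using P_fixed core less(2) by blast+
        have Ps: "P s \<in> S" by (rule P_closed[OF less(2)])
        have "{f s, f (P s)} \<in> E"
          using fE[OF less(2) Ps] edge_iff[OF less(2) Ps] ne by simp
        then consider "P (f s) = f (P s)" | "P (f (P s)) = f s"
          using edge_iff[OF mem[OF less(2)] mem[OF Ps]] fs by blast
        then show ?thesis
        proof cases
          \<comment> \<open>The edge would be turned upside down. The induction hypothesis for
            \<open>P s\<close> gives \<open>f (P (P s)) = f s\<close>, so \<open>s\<close> and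
            \<open>P s\<close> would be parents of each other.\<close>
          case 2
          have "f (P (P s)) = f s" using less(1)[OF d[OF less(2) ne] Ps] 2 by simp
          then have PP: "P (P s) = s" using inj[OF P_closed[OF Ps] less(2)] by simp
          then have "d s < d (P s)" using d[OF Ps] ne by simp
          then show ?thesis using d[OF less(2) ne] by simp
        qed simp
      qed
    qed
    have "Q (fst (f (froot T x))) (fst (f (froot T y))) \<longleftrightarrow> Q x y" if "x \<in> \<Omega>" "y \<in> \<Omega>" for x y
    proof -
      let ?s = "froot T x" and ?t = "froot T y"
      have st: "?s \<in> R" "?t \<in> R" "?s \<in> S" "?t \<in> S" using that R_subset by auto
      then have fst: "f ?s \<in> R" "f ?t \<in> R"
        using core by blast+
      then have "P ?s = ?s" "P ?t = ?t" "P (f ?s) = f ?s" "P (f ?t) = f ?t"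
        using P_fixed mem st by blast+
      then show ?thesis
        using edge_iff[OF mem[OF st(3)] mem[OF st(4)]] edge_iff[OF st(3,4)] fE[OF st(3,4)] st(1,2) fst
        by (metis fst_froot)
    qed
    then show "f \<in> carrier (forest_aut \<Omega> T Q)"
      using fB comm by (simp add: forest_aut_def)
  next
    assume "f \<in> carrier (forest_aut \<Omega> T Q)"
    then have fB: "f \<in> Bij S" and bij: "bij_betw f S S"
      and comm: "\<And>s. s \<in> S \<Longrightarrow> f (P s) = P (f s)"
      and fQ: "\<And>x y. \<lbrakk>x \<in> \<Omega>; y \<in> \<Omega>\<rbrakk> \<Longrightarrow> Q (fst (f (froot T x))) (fst (f (froot T y))) \<longleftrightarrow> Q x y"
      by (auto simp: forest_aut_def Bij_def)
    have mem: "f s \<in> S" if "s \<in> S" for s using bij that by (rule bij_betw_apply)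
    have inj: "f s = f t \<longleftrightarrow> s = t" if "s \<in> S" "t \<in> S" for s t
      using bij that by (auto simp: bij_betw_def inj_on_def)
    have core: "f s \<in> R \<longleftrightarrow> s \<in> R" if "s \<in> S" for s
      unfolding P_fixed[OF that, symmetric] P_fixed[OF mem[OF that], symmetric] comm[OF that, symmetric]
      by (rule inj[OF P_closed[OF that] that])
    have "{f s, f t} \<in> E \<longleftrightarrow> {s, t} \<in> E" if st: "s \<in> S" "t \<in> S" for s t
    proof -
      have "Q (fst (f s)) (fst (f t)) \<longleftrightarrow> Q (fst s) (fst t)" if "s \<in> R" "t \<in> R"
        using that fQ by auto
      moreover have "P (f s) = f t \<longleftrightarrow> P s = t" "P (f t) = f s \<longleftrightarrow> P t = s"
        using comm inj P_closed st by metis+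
      ultimately show ?thesis
        unfolding edge_iff[OF mem[OF st(1)] mem[OF st(2)]] edge_iff[OF st] core[OF st(1)] core[OF st(2)]
          inj[OF st] by blast
    qed
    then show "f \<in> carrier (Aut S E)"
      using fB by (simp add: Aut_def)
  qed
  then show ?thesis
    by (auto simp: Aut_def forest_aut_def)
qed

section \<open>Simplicity, connectedness and cyclomatic number of the graph with attached
  trees\<close>

lemma simple_graph_attach: "simple_graph S E"
  unfolding simple_graph_def
proof (rule conjI[OF finite_S], rule ballI)
  fix e assume "e \<in> E"
  then consider x y where "e = {froot T x, froot T y}" "x \<in> \<Omega>" "y \<in> \<Omega>" "Q x y"
    | s where "e = {s, P s}" "s \<in> S" "P s \<noteq> s"
    unfolding attach_edges_def by blast
  then obtain s t where "e = {s, t}" "s \<in> S" "t \<in> S" "s \<noteq> t"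
  proof cases
    case 1
    then show thesis using that[of "froot T x" "froot T y"] Q_irrefl[of x] R_subset by auto
  next
    case 2
    then show thesis using that[of s "P s"] P_closed by simp
  qed
  then show "e \<subseteq> S \<and> card e = 2" by simp
qed

lemma connected_graph_attach:
  assumes "\<Omega> \<noteq> {}"
    and conn: "\<And>x y. \<lbrakk>x \<in> \<Omega>; y \<in> \<Omega>\<rbrakk> \<Longrightarrow> (x, y) \<in> {(x, y). x \<in> \<Omega> \<and> y \<in> \<Omega> \<and> Q x y}\<^sup>*"
  shows "connected_graph S E"
proof -
  let ?r = "{(x, y). {x, y} \<in> E}"
  have sym: "(t, s) \<in> ?r\<^sup>*" if "(s, t) \<in> ?r\<^sup>*" for s t
    using that by (rule symD[OF sym_rtrancl, rotated]) (auto simp: sym_def insert_commute)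
  have root: "((x, v), froot T x) \<in> ?r\<^sup>*" if "x \<in> \<Omega>" "v \<in> verts (T x)" for x v
    using tree[OF that(1)] that(2)
  proof (induction rule: rooted_tree_induct)
    case (par v)
    have "((x, v), (x, par (T x) v)) \<in> ?r"
      using par that(1) D(5)[OF that(1) par(1)]
      by (auto simp: attach_edges_def fverts_def fpar_def intro!: exI[of _ x] exI[of _ v])
    then show ?case using par(3) by (rule converse_rtrancl_into_rtrancl)
  qed (simp add: froot_def)
  have core: "(froot T x, froot T y) \<in> ?r\<^sup>*" if "x \<in> \<Omega>" "y \<in> \<Omega>" for x y
    using conn[OF that]
  proof (induction rule: rtrancl_induct)
    case (step y z)
    then have "(froot T y, froot T z) \<in> ?r" by (auto simp: attach_edges_def)
    with step(3) show ?case by (rule rtrancl_into_rtrancl)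
  qed simp
  have "(s, t) \<in> ?r\<^sup>*" if "s \<in> S" "t \<in> S" for s t
  proof -
    from that obtain x v y w where *: "s = (x, v)" "x \<in> \<Omega>" "v \<in> verts (T x)"
      "t = (y, w)" "y \<in> \<Omega>" "w \<in> verts (T y)" by (auto simp: fverts_def)
    have "(s, froot T y) \<in> ?r\<^sup>*"
      using root[OF *(2,3)] core[OF *(2,5)] unfolding *(1) by (rule rtrancl_trans)
    then show ?thesis
      using sym[OF root[OF *(5,6)]] unfolding *(4) by (rule rtrancl_trans)
  qed
  moreover have "S \<noteq> {}" using assms(1) R_subset by auto
  ultimately show ?thesis by (simp add: connected_graph_def)
qed

text \<open>Each vertex outside the core brings exactly one edge with it, the one to its parent, so
  the difference between edges and vertices is that of the core.\<close>

lemma cyclomatic_number_attach: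
  "cyclomatic_number S E = cyclomatic_number \<Omega> {{x, y} | x y. x \<in> \<Omega> \<and> y \<in> \<Omega> \<and> Q x y}"
proof -
  let ?E0 = "{{x, y} | x y. x \<in> \<Omega> \<and> y \<in> \<Omega> \<and> Q x y}"
  let ?E1 = "{{froot T x, froot T y} | x y. x \<in> \<Omega> \<and> y \<in> \<Omega> \<and> Q x y}"
  let ?E2 = "(\<lambda>s. {s, P s}) ` (S - R)"
  obtain d where d: "\<And>s. \<lbrakk>s \<in> S; P s \<noteq> s\<rbrakk> \<Longrightarrow> (d (P s) :: nat) < d s"
    using forest_depth[of \<Omega> T, OF tree] by blast
  have E: "E = ?E1 \<union> ?E2"
  proof -
    have "S - R = {s \<in> S. P s \<noteq> s}" using P_fixed by blast
    then show ?thesis unfolding attach_edges_def by blast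
  qed
  have inj: "inj_on (froot T) A" for A
    by (auto simp: inj_on_def froot_def)
  have E1: "?E1 = (`) (froot T) ` ?E0"
  proof (intro equalityI subsetI)
    fix e assume "e \<in> ?E1"
    then obtain x y where "x \<in> \<Omega>" "y \<in> \<Omega>" "Q x y" "e = froot T ` {x, y}" by auto
    then show "e \<in> (`) (froot T) ` ?E0" by blast
  next
    fix e assume "e \<in> (`) (froot T) ` ?E0"
    then obtain x y where "x \<in> \<Omega>" "y \<in> \<Omega>" "Q x y" "e = froot T ` {x, y}" by blast
    then show "e \<in> ?E1" by auto
  qed
  have "inj_on ((`) (froot T)) ?E0"
    by (rule inj_on_image) (rule inj)
  then have "card ?E1 = card ?E0"
    unfolding E1 by (rule card_image)
  \<comment> \<open>Two different vertices with the same edge would be parents of each other,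
    contrary to the rank.\<close>
  moreover have "inj_on (\<lambda>s. {s, P s}) (S - R)"
  proof (rule inj_onI)
    fix s t assume st: "s \<in> S - R" "t \<in> S - R" "{s, P s} = {t, P t}"
    then have "d (P s) < d s" "d (P t) < d t" using d P_fixed by blast+
    with st(3) show "s = t" by (metis doubleton_eq_iff less_asym)
  qed
  then have "card ?E2 = card (S - R)" by (rule card_image)
  \<comment> \<open>An edge in \<open>?E1\<close> lies within the core, one in \<open>?E2\<close>
    contains a vertex outside it.\<close>
  moreover have "?E1 \<inter> ?E2 = {}"
    by blast
  moreover have "finite ?E0"
    by (rule finite_subset[of _ "Pow \<Omega>"]) (use fin in auto)
  then have "finite ?E1" by (simp add: E1)
  moreover have "finite ?E2" using finite_S by simp
  ultimately have "card E = card ?E0 + card (S - R)"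
    unfolding E by (simp only: card_Un_disjoint)
  moreover have "card S = card \<Omega> + card (S - R)"
  proof -
    have "card R = card \<Omega>" by (rule card_image[OF inj])
    then show ?thesis
      using card_Diff_subset[of R S] card_mono[OF finite_S R_subset] fin R_subset by simp
  qed
  ultimately show ?thesis by (simp add: cyclomatic_number_def)
qed

end


section \<open>Transport of graphs along injections\<close>

lemma
  assumes h: "inj h" and "simple_graph V E"
  shows Aut_image: "Aut V E \<cong> Aut (h ` V) ((`) h ` E)"
    and bicyclic_image: "bicyclic V E \<Longrightarrow> bicyclic (h ` V) ((`) h ` E)"
proof -
  have inj: "inj ((`) h)" using inj_on_image[of h UNIV] h by simp
  have E: "{h u, h v} \<in> (`) h ` E \<longleftrightarrow> {u, v} \<in> E" for u v
    using inj_image_mem_iff[OF inj, of "{u, v}" E] by simp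
  have bij: "bij_betw h V (h ` V)"
    using h by (simp add: inj_on_imp_bij_betw inj_on_subset)
  have inv: "inv_into V h (h x) = x" if "x \<in> V" for x
    using bij that by (simp add: bij_betw_def)
  show "Aut V E \<cong> Aut (h ` V) ((`) h ` E)"
    unfolding Aut_def
  proof (rule compose_in_Bij_iso[OF bij])
    fix f assume f: "f \<in> Bij V"
    let ?F = "\<lambda>y\<in>h ` V. h (f (inv_into V h y))"
    have "bij_betw (h \<circ> (f \<circ> inv_into V h)) (h ` V) (h ` V)"
      using f bij bij_betw_inv_into[OF bij] by (auto simp: Bij_def intro!: bij_betw_trans)
    then have "bij_betw ?F (h ` V) (h ` V)"
      by (rule bij_betw_cong[THEN iffD1, rotated]) simp
    then have "?F \<in> Bij (h ` V)"
      by (simp add: Bij_def)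
    moreover have "(\<forall>u\<in>h ` V. \<forall>v\<in>h ` V. {?F u, ?F v} \<in> (`) h ` E \<longleftrightarrow> {u, v} \<in> (`) h ` E)
      \<longleftrightarrow> (\<forall>u\<in>V. \<forall>v\<in>V. {f u, f v} \<in> E \<longleftrightarrow> {u, v} \<in> E)"
      by (simp add: E inv)
    ultimately show "f \<in> {f \<in> Bij V. \<forall>u\<in>V. \<forall>v\<in>V. {f u, f v} \<in> E \<longleftrightarrow> {u, v} \<in> E}
      \<longleftrightarrow> ?F \<in> {f \<in> Bij (h ` V). \<forall>u\<in>h ` V. \<forall>v\<in>h ` V.
            {f u, f v} \<in> (`) h ` E \<longleftrightarrow> {u, v} \<in> (`) h ` E}"
      using f by simp
  qed auto
  assume B: "bicyclic V E"
  have "simple_graph (h ` V) ((`) h ` E)"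
    using B h unfolding bicyclic_def simple_graph_def
    by (auto simp: card_image[OF inj_on_subset[OF h subset_UNIV]])
  moreover have "connected_graph (h ` V) ((`) h ` E)"
  proof -
    have "(h u, h v) \<in> {(x, y). {x, y} \<in> (`) h ` E}\<^sup>*" if "u \<in> V" "v \<in> V" for u v
    proof -
      have "(u, v) \<in> {(x, y). {x, y} \<in> E}\<^sup>*"
        using B that by (auto simp: bicyclic_def connected_graph_def)
      then show ?thesis
      proof (induction rule: rtrancl_induct)
        case (step y z)
        then have "(h y, h z) \<in> {(x, y). {x, y} \<in> (`) h ` E}" by (simp add: E)
        with step(3) show ?case by (rule rtrancl_into_rtrancl)
      qed simp
    qed
    then show ?thesis
      using B by (auto simp: bicyclic_def connected_graph_def)
  qed
  moreover have "cyclomatic_number (h ` V) ((`) h ` E) = cyclomatic_number V E"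
    using h inj by (simp add: cyclomatic_number_def card_image inj_on_subset)
  ultimately show "bicyclic (h ` V) ((`) h ` E)"
    using B by (simp add: bicyclic_def)
qed


section \<open>The bicyclic core\<close>

text \<open>The core is a theta graph with hubs \<open>(2, 0)\<close> and \<open>(2, 1)\<close>, which are joined by a path of length
  two through \<open>(2, 2)\<close> and by paths of length four through \<open>(0, 2)\<close> and through \<open>(1, 2)\<close>. Its
  automorphisms are the translations modulo 2 of the coordinates different from 2.\<close>

definition core :: "(int \<times> int) set"
  where "core = {0, 1, 2} \<times> {0, 1, 2}"

text \<open>For \<open>i\<close> and \<open>j\<close> in \<open>{0, 1}\<close> the vertex
  \<open>(i, j)\<close> lies on the long path \<open>i\<close> next to the hub \<open>j\<close>; a
  coordinate 2 marks a vertex that belongs to no particular long path or to no particular hub. Each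
  edge is listed in one direction only, so arcs count edges.\<close>

definition core_arcs :: "((int \<times> int) \<times> (int \<times> int)) set"
  where "core_arcs = {((0, 0), (2, 0)), ((1, 0), (2, 0)), ((0, 1), (2, 1)), ((1, 1), (2, 1)),
    ((0, 0), (0, 2)), ((0, 1), (0, 2)), ((1, 0), (1, 2)), ((1, 1), (1, 2)),
    ((2, 0), (2, 2)), ((2, 1), (2, 2))}"

definition core_adj :: "int \<times> int \<Rightarrow> int \<times> int \<Rightarrow> bool"
  where "core_adj x y \<longleftrightarrow> (x, y) \<in> core_arcs \<or> (y, x) \<in> core_arcs"

text \<open>Through its first coordinate \<open>k\<close> acts on the two long paths, through its
  second on the two hubs.\<close>

definition translate :: "int \<times> int \<Rightarrow> int \<times> int \<Rightarrow> int \<times> int"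
  where "translate k x = (if fst x = 2 then 2 else (fst x + fst k) mod 2,
    if snd x = 2 then 2 else (snd x + snd k) mod 2)"

lemma Z2xZ2_mult: "(a, b) \<otimes>\<^bsub>Z2xZ2\<^esub> (c, d) = ((a + c) mod 2, (b + d) mod 2)"
  by (simp add: Z2xZ2_def integer_mod_group_def)

lemma translate_mult:
  "translate (k \<otimes>\<^bsub>Z2xZ2\<^esub> l) x = translate k (translate l x)"
proof -
  \<comment> \<open>A translated coordinate is reduced modulo 2 and so is never mistaken for the
    marker 2 by the next translation.\<close>
  have "a mod 2 \<noteq> 2" for a :: int by (metis pos_mod_bound less_irrefl zero_less_numeral)
  then show ?thesis
    by (cases k; cases l) (simp add: translate_def Z2xZ2_mult mod_simps ac_simps)
qed

lemma Z2xZ2_cases: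
  assumes "k \<in> carrier Z2xZ2"
  shows "k = (0, 0) \<or> k = (0, 1) \<or> k = (1, 0) \<or> k = (1, 1)"
  using assms by (auto simp: carrier_Z2xZ2)

lemma core_cases:
  assumes "x \<in> core"
  shows "x = (0, 0) \<or> x = (0, 1) \<or> x = (0, 2) \<or> x = (1, 0) \<or> x = (1, 1) \<or> x = (1, 2) \<or>
    x = (2, 0) \<or> x = (2, 1) \<or> x = (2, 2)"
  using assms unfolding core_def by blast

lemma translate_core:
  assumes "k \<in> carrier Z2xZ2"
  shows "bij_betw (translate k) core core"
    and "x \<in> core \<Longrightarrow> fst (translate k x) = 2 \<longleftrightarrow> fst x = 2"
    and "x \<in> core \<Longrightarrow> snd (translate k x) = 2 \<longleftrightarrow> snd x = 2"
    and "\<lbrakk>x \<in> core; y \<in> core\<rbrakk> \<Longrightarrow> core_adj (translate k x) (translate k y) \<longleftrightarrow> core_adj x y"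
proof -
  have cl: "translate k x \<in> core" if "x \<in> core" for x
    using Z2xZ2_cases[OF assms] core_cases[OF that]
    by (elim disjE) (simp_all add: translate_def core_def)
  \<comment> \<open>Being its own inverse, the translation is bijective, and one direction of the
    adjacency statement yields the other.\<close>
  have inv: "translate k (translate k x) = x" if "x \<in> core" for x
    using Z2xZ2_cases[OF assms] core_cases[OF that]
    by (elim disjE) (simp_all add: translate_def)
  show "bij_betw (translate k) core core"
    by (rule bij_betwI[where g = "translate k"]) (use cl inv in auto)
  show "fst (translate k x) = 2 \<longleftrightarrow> fst x = 2" "snd (translate k x) = 2 \<longleftrightarrow> snd x = 2" if "x \<in> core"
    using Z2xZ2_cases[OF assms] core_cases[OF that]
    by (elim disjE; simp add: translate_def)+
  have arcs: "(translate k x, translate k y) \<in> core_arcs" if "(x, y) \<in> core_arcs" for x y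
    using Z2xZ2_cases[OF assms] that unfolding core_arcs_def
    by (elim disjE insertE emptyE) (simp_all add: translate_def)
  show "core_adj (translate k x) (translate k y) \<longleftrightarrow> core_adj x y" if "x \<in> core" "y \<in> core"
    using arcs[of x y] arcs[of y x] arcs[of "translate k x" "translate k y"]
      arcs[of "translate k y" "translate k x"] inv[OF that(1)] inv[OF that(2)]
    by (auto simp: core_adj_def)
qed

text \<open>The positions of the coordinates 2 distinguish the four kinds of vertices; the sizes of
  the attached trees will enforce \<open>fst\<close> and \<open>snd\<close>. Hence
  \<open>\<sigma>\<close> induces a permutation \<open>p\<close> of the long paths, read off at
  their midpoints, and \<open>q\<close> of the hubs. As \<open>(i, j)\<close> is the only vertex of
  its kind adjacent to both \<open>(i, 2)\<close> and \<open>(2, j)\<close>, its image is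
  determined.\<close>

lemma core_aut_is_translation:
  assumes bij: "bij_betw \<sigma> core core"
    and fst: "\<And>x. x \<in> core \<Longrightarrow> fst (\<sigma> x) = 2 \<longleftrightarrow> fst x = 2"
    and snd: "\<And>x. x \<in> core \<Longrightarrow> snd (\<sigma> x) = 2 \<longleftrightarrow> snd x = 2"
    and adj: "\<And>x y. \<lbrakk>x \<in> core; y \<in> core; core_adj x y\<rbrakk> \<Longrightarrow> core_adj (\<sigma> x) (\<sigma> y)"
  shows "\<exists>k\<in>carrier Z2xZ2. \<forall>x\<in>core. \<sigma> x = translate k x"
proof -
  let ?B = "{0, 1} :: int set"
  have mem: "\<sigma> x \<in> core" if "x \<in> core" for x
    using bij that by (rule bij_betw_apply)
  have inj: "\<sigma> x \<noteq> \<sigma> y" if "x \<in> core" "y \<in> core" "x \<noteq> y" for x y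
    using bij that by (auto simp: bij_betw_def inj_on_def)
  have core_adj_iff: "core_adj (a, b) (c, 2) \<longleftrightarrow> a = c" "core_adj (a, b) (2, c) \<longleftrightarrow> b = c"
    if "a \<in> ?B" "b \<in> ?B" "c \<in> ?B" for a b c
    using that by (auto simp: core_adj_def core_arcs_def)
  have B: "?B \<times> ?B \<subseteq> core" "?B \<times> {2} \<subseteq> core" "{2} \<times> ?B \<subseteq> core"
    by (auto simp: core_def)
  obtain p where p: "\<And>i. i \<in> ?B \<Longrightarrow> \<sigma> (i, 2) = (p i, 2)" "\<And>i. i \<in> ?B \<Longrightarrow> p i \<in> ?B"
  proof
    fix i assume i: "i \<in> ?B"
    then have x: "(i, 2) \<in> core" using B by blast
    show "\<sigma> (i, 2) = (fst (\<sigma> (i, 2)), 2)" "fst (\<sigma> (i, 2)) \<in> ?B"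
      using mem[OF x] fst[OF x] snd[OF x] i by (auto simp: prod_eq_iff core_def)
  qed
  obtain q where q: "\<And>j. j \<in> ?B \<Longrightarrow> \<sigma> (2, j) = (2, q j)" "\<And>j. j \<in> ?B \<Longrightarrow> q j \<in> ?B"
  proof
    fix i assume i: "i \<in> ?B"
    then have x: "(2, i) \<in> core" using B by blast
    show "\<sigma> (2, i) = (2, snd (\<sigma> (2, i)))" "snd (\<sigma> (2, i)) \<in> ?B"
      using mem[OF x] fst[OF x] snd[OF x] i by (auto simp: prod_eq_iff core_def)
  qed
  have \<sigma>: "\<sigma> (i, j) = (p i, q j)" if ij: "i \<in> ?B" "j \<in> ?B" for i j
  proof -
    obtain a b where ab: "\<sigma> (i, j) = (a, b)" by fastforce
    have x: "(i, j) \<in> core" "(i, 2) \<in> core" "(2, j) \<in> core" using ij B by blast+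
    have "a \<in> ?B" "b \<in> ?B"
      using mem[OF x(1)] fst[OF x(1)] snd[OF x(1)] ab ij by (auto simp: core_def)
    moreover have "core_adj (a, b) (p i, 2)" "core_adj (a, b) (2, q j)"
      using adj[OF x(1,2)] adj[OF x(1,3)] core_adj_iff(1)[OF ij ij(1)] core_adj_iff(2)[OF ij ij(2)]
        ab p(1)[OF ij(1)] q(1)[OF ij(2)] by simp_all
    ultimately show ?thesis
      using core_adj_iff(1)[of a b "p i"] core_adj_iff(2)[of a b "q j"] p(2)[OF ij(1)] q(2)[OF ij(2)] ab
      by simp
  qed
  \<comment> \<open>A permutation of \<open>{0, 1}\<close> is the translation by its value at 0,
    whence the element \<open>(p 0, q 0)\<close>.\<close>
  have "p 0 \<noteq> p 1" "q 0 \<noteq> q 1"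
    using inj[of "(0, 2)" "(1, 2)"] inj[of "(2, 0)" "(2, 1)"] p(1)[of 0] p(1)[of 1] q(1)[of 0] q(1)[of 1]
    by (simp_all add: core_def)
  then have pq: "p 0 = 0 \<and> p 1 = 1 \<or> p 0 = 1 \<and> p 1 = 0" "q 0 = 0 \<and> q 1 = 1 \<or> q 0 = 1 \<and> q 1 = 0"
    using p(2)[of 0] p(2)[of 1] q(2)[of 0] q(2)[of 1] by auto
  have "\<sigma> (2, 2) = (2, 2)"
    using fst[of "(2, 2)"] snd[of "(2, 2)"] by (simp add: core_def prod_eq_iff)
  then have "\<sigma> x = translate (p 0, q 0) x" if "x \<in> core" for x
    using core_cases[OF that] pq p(1)[of 0] p(1)[of 1] q(1)[of 0] q(1)[of 1]
      \<sigma>[of 0 0] \<sigma>[of 0 1] \<sigma>[of 1 0] \<sigma>[of 1 1]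
    by (elim disjE) (simp_all add: translate_def)
  moreover have "(p 0, q 0) \<in> carrier Z2xZ2"
    using pq by (auto simp: carrier_Z2xZ2)
  ultimately show ?thesis by blast
qed

lemma core_arcs_subset: "core_arcs \<subseteq> core \<times> core"
  by (simp add: core_arcs_def core_def)

lemma cyclomatic_number_core:
  "cyclomatic_number core {{x, y} | x y. x \<in> core \<and> y \<in> core \<and> core_adj x y} = 2"
proof -
  have "{{x, y} | x y. x \<in> core \<and> y \<in> core \<and> core_adj x y} = (\<lambda>(x, y). {x, y}) ` core_arcs"
  proof (intro equalityI subsetI, goal_cases)
    case (1 e)
    then obtain x y where "e = {x, y}" "core_adj x y" by blast
    then show ?case
      unfolding core_adj_def by (auto simp: insert_commute intro: rev_image_eqI)
  next
    case (2 e)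
    then obtain x y where "e = {x, y}" "(x, y) \<in> core_arcs" by auto
    then show ?case using core_arcs_subset unfolding core_adj_def by blast
  qed
  also have "card \<dots> = card core_arcs"
    by (rule card_image) (auto simp: inj_on_def core_arcs_def doubleton_eq_iff)
  also have "\<dots> = 10"
    by (simp add: core_arcs_def)
  \<comment> \<open>Ten edges and nine vertices give \<open>10 - 9 + 1 = 2\<close>.\<close>
  finally show ?thesis
    by (simp add: cyclomatic_number_def core_def card_cartesian_product)
qed

lemma core_connected:
  assumes "x \<in> core" "y \<in> core"
  shows "(x, y) \<in> {(x, y). x \<in> core \<and> y \<in> core \<and> core_adj x y}\<^sup>*"
proof -
  let ?r = "{(x, y). x \<in> core \<and> y \<in> core \<and> core_adj x y}"
  have sym: "sym (?r\<^sup>*)"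
    by (rule sym_rtrancl) (auto simp: sym_def core_adj_def)
  have arc: "(x, y) \<in> ?r\<^sup>*" if "(x, y) \<in> core_arcs" for x y
    using that core_arcs_subset by (blast intro: r_into_rtrancl core_adj_def[THEN iffD2])
  have 1: "((2, j), (2, 2)) \<in> ?r\<^sup>*" if "j = 0 \<or> j = 1 \<or> j = 2" for j
    using that arc[of "(2, j)" "(2, 2)"] by (elim disjE) (simp_all add: core_arcs_def)
  have 2: "((i, j), (2, 2)) \<in> ?r\<^sup>*" if "i = 0 \<or> i = 1" "j = 0 \<or> j = 1" for i j
  proof -
    have "((i, j), (2, j)) \<in> ?r\<^sup>*"
      using that arc[of "(i, j)" "(2, j)"] by (elim disjE) (simp_all add: core_arcs_def)
    then show ?thesis using that 1[of j] by (blast intro: rtrancl_trans)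
  qed
  have 3: "((i, 2), (2, 2)) \<in> ?r\<^sup>*" if "i = 0 \<or> i = 1" for i
  proof -
    have "((i, 0), (i, 2)) \<in> ?r\<^sup>*"
      using that arc[of "(i, 0)" "(i, 2)"] by (elim disjE) (simp_all add: core_arcs_def)
    then show ?thesis using that 2[of i 0] symD[OF sym] by (blast intro: rtrancl_trans)
  qed
  have "(x, (2, 2)) \<in> ?r\<^sup>*" if "x \<in> core" for x
    using core_cases[OF that] 1 2 3 by (elim disjE) simp_all
  then show ?thesis
    using assms sym by (meson symD rtrancl_trans)
qed

text \<open>No graph remains after this lemma: it suffices to identify \<open>M\<close> with the
  permutations of nine trees that respect the core, combined with automorphisms of the
  trees.\<close>

lemma bicyclic_core_attach:
  fixes T :: "int \<times> int \<Rightarrow> nat rtree"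
  assumes tree: "\<And>x. x \<in> core \<Longrightarrow> rooted_tree (T x)"
    and M: "M \<cong> forest_aut core T core_adj"
  shows "\<exists>(V :: nat set) (E :: nat set set). bicyclic V E \<and> M \<cong> Aut V E"
proof -
  interpret attached_trees core core_adj T
  proof
    show "finite core" by (simp add: core_def)
    show "core_adj x y \<Longrightarrow> core_adj y x" for x y
      by (auto simp: core_adj_def)
    show "\<not> core_adj x x" for x
      by (auto simp: core_adj_def core_arcs_def)
    show "\<exists>y\<in>core. \<exists>z\<in>core. y \<noteq> z \<and> core_adj x y \<and> core_adj x z" if "x \<in> core" for x
    proof -
      \<comment> \<open>Two neighbours for each kind of vertex: hub and midpoint for
        \<open>(i, j)\<close>, the points \<open>(i, 0)\<close> and \<open>(i, 1)\<close> for a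
        midpoint, the first points of both long paths for a hub, and both hubs for
        \<open>(2, 2)\<close>.\<close>
      define y where "y = (if fst x \<noteq> 2 then if snd x \<noteq> 2 then (2, snd x) else (fst x, 0)
        else if snd x \<noteq> 2 then (0, snd x) else (2, 0))"
      define z where "z = (if fst x \<noteq> 2 then if snd x \<noteq> 2 then (fst x, 2) else (fst x, 1)
        else if snd x \<noteq> 2 then (1, snd x) else (2, 1))"
      have "y \<in> core" "z \<in> core" "y \<noteq> z" "core_adj x y" "core_adj x z"
        using core_cases[OF that]
        by (elim disjE; simp add: y_def z_def core_def core_adj_def core_arcs_def)+
      then show ?thesis by blast
    qed
  qed (rule tree)
  have "core \<noteq> {}" by (simp add: core_def)
  from connected_graph_attach[OF this core_connected] have "bicyclic S E"
    unfolding bicyclic_def cyclomatic_number_attach cyclomatic_number_core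
    using simple_graph_attach by blast
  moreover have "inj (to_nat :: (int \<times> int) \<times> nat \<Rightarrow> nat)" by simp
  ultimately show ?thesis
    using bicyclic_image Aut_image simple_graph_attach iso_trans[OF M[folded Aut_eq_forest_aut]] by blast
qed


section \<open>Realizing the groups\<close>

text \<open>Tree and isomorphism are chosen once for each size. Points that are given the same group
  and size then carry literally the same tree, as \<open>col\<close> in
  \<open>iso_forest_aut\<close> demands.\<close>

lemma \<T>_nat_trees:
  assumes "G \<in> \<T>_nat"
  obtains N t i where "\<And>n. N \<le> n \<Longrightarrow> rooted_tree (t n :: nat rtree)"
    "\<And>n. N \<le> n \<Longrightarrow> card (verts (t n)) = n" "\<And>n. N \<le> n \<Longrightarrow> i n \<in> iso G (tree_aut (t n))"
proof -
  obtain t0 :: "nat rtree" where t0: "rooted_tree t0" "G \<cong> tree_aut t0"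
    using \<T>_nat_tree[OF assms] by blast
  let ?N = "card (verts t0)"
  have "\<forall>n\<in>{?N..}. \<exists>t :: nat rtree. rooted_tree t \<and> G \<cong> tree_aut t \<and> card (verts t) = n"
    using tree_with_card[OF t0] by simp
  from bchoice[OF this] obtain t :: "nat \<Rightarrow> nat rtree"
    where t: "\<forall>n\<in>{?N..}. rooted_tree (t n) \<and> G \<cong> tree_aut (t n) \<and> card (verts (t n)) = n" by blast
  then have "\<forall>n\<in>{?N..}. \<exists>i. i \<in> iso G (tree_aut (t n))"
    by (auto simp: is_iso_def)
  from bchoice[OF this] obtain i where "\<forall>n\<in>{?N..}. i n \<in> iso G (tree_aut (t n))" by blast
  with t show thesis by (intro that[of ?N t i]) simp_all
qed

text \<open>Supplies trees without nontrivial automorphisms for those points of the core that are to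
  contribute nothing to the group.\<close>

definition one_group :: "nat monoid"
  where "one_group = \<lparr>carrier = {0}, monoid.mult = \<lambda>_ _. 0, one = 0\<rparr>"

lemma one_group_\<T>_nat: "one_group \<in> \<T>_nat"
proof (rule \<T>_nat.trivial)
  show "group one_group" by (rule groupI) (simp_all add: one_group_def)
qed (simp add: one_group_def)

lemma one_group_simps [simp]: "carrier one_group = {0}" "x \<otimes>\<^bsub>one_group\<^esub> y = 0"
  by (simp_all add: one_group_def)

lemma \<T>_bicyclic:
  assumes "C \<in> \<T>_nat"
  shows "\<exists>(V :: nat set) (E :: nat set set). bicyclic V E \<and> C \<cong> Aut V E"
proof -
  obtain N t i where t: "\<And>n. N \<le> n \<Longrightarrow> rooted_tree (t n :: nat rtree)"
    "\<And>n. N \<le> n \<Longrightarrow> card (verts (t n)) = n" and i: "\<And>n. N \<le> n \<Longrightarrow> i n \<in> iso C (tree_aut (t n))"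
    using \<T>_nat_trees[OF assms] by blast
  obtain N' u j where u: "\<And>n. N' \<le> n \<Longrightarrow> rooted_tree (u n :: nat rtree)"
    "\<And>n. N' \<le> n \<Longrightarrow> card (verts (u n)) = n" and j: "\<And>n. N' \<le> n \<Longrightarrow> j n \<in> iso one_group (tree_aut (u n))"
    using \<T>_nat_trees[OF one_group_\<T>_nat] by blast
  \<comment> \<open>\<open>3 * fst x + snd x\<close> numbers the nine core points from 0 to 8, so
    all sizes differ; \<open>N + N'\<close> makes them large enough for both families of
    trees.\<close>
  define size where "size x = N + N' + nat (3 * fst x + snd x)" for x :: "int \<times> int"
  define T where "T x = (if x = (2, 2) then t (size x) else u (size x))" for x
  have size: "N \<le> size x" "N' \<le> size x" for x by (simp_all add: size_def)
  have tree: "rooted_tree (T x)" and card: "card (verts (T x)) = size x" for x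
    using t[OF size(1)] u[OF size(2)] by (simp_all add: T_def)
  have size_inj: "x = y" if "size x = size y" "x \<in> core" "y \<in> core" for x y
    using that(1) core_cases[OF that(2)] core_cases[OF that(3)]
    by (elim disjE) (simp_all add: size_def)
  note i = isoD[OF i[OF size(1)]] and j = isoD[OF j[OF size(2)]]
  define \<gamma> where "\<gamma> m x = (if x = (2, 2) then i (size x) m else j (size x) 0)" for m x
  have "C \<cong> forest_aut core T core_adj"
  proof (rule iso_forest_aut[where act = "\<lambda>_ x. x" and \<gamma> = \<gamma>], goal_cases)
    case (9 m m' x)
    then show ?case
      using i(2)[of m m' x] j(2)[of 0 0 x] by (cases "x = (2, 2)") (simp_all add: T_def \<gamma>_def)
  next
    case (10 m m')
    then show ?case
      using 10(4)[of "(2, 2)"] i(3)[of m m' "(2, 2)"] by (simp add: \<gamma>_def core_def)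
  next
    case (11 \<sigma> g)
    have "\<sigma> x = x" if "x \<in> core" for x
    proof (rule size_inj[OF _ _ that])
      show "size (\<sigma> x) = size x" using 11(2)[OF that] card by metis
    qed (use bij_betw_apply[OF 11(1) that] in simp)
    moreover obtain m where m: "m \<in> carrier C" "i (size (2, 2)) m = g (2, 2)"
      using 11(4)[of "(2, 2)"] i(4)[of "g (2, 2)" "(2, 2)"] by (auto simp: T_def core_def)
    moreover have "\<gamma> m x = g x" if x: "x \<in> core" for x
    proof (cases "x = (2, 2)")
      case False
      then show ?thesis
        using 11(4)[OF x] j(4)[of "g x" x] by (auto simp: \<gamma>_def T_def)
    qed (simp add: \<gamma>_def m)
    ultimately show ?case by (intro bexI[of _ m]) simp_all
  next
    case (3 x y)
    then show ?case using size_inj[of x y] by (simp only: card)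
  next
    case (7 m x)
    then show ?case using i(1)[of m x] j(1)[of 0 x]
      by (cases "x = (2, 2)") (simp_all add: T_def \<gamma>_def)
  qed (use tree in \<open>simp_all add: core_def bij_betw_def\<close>)
  then show ?thesis using bicyclic_core_attach tree by blast
qed

text \<open>The group \<open>M\<close> acts on the core through \<open>s\<close>. The remaining maps are the coordinates of an
  element at \<open>(2, 2)\<close>, at the points \<open>(i, j)\<close>, \<open>(i, 2)\<close> and \<open>(2, j)\<close> with \<open>i, j \<in> {0, 1}\<close>.\<close>

lemma core_group_bicyclic:
  fixes s :: "'m \<Rightarrow> int \<times> int" and d :: "'m \<Rightarrow> int \<times> int \<Rightarrow> nat" and e f :: "'m \<Rightarrow> int \<Rightarrow> nat"
  assumes \<T>: "C \<in> \<T>_nat" "D \<in> \<T>_nat" "H \<in> \<T>_nat" "K \<in> \<T>_nat"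
    and s: "\<And>m. m \<in> carrier M \<Longrightarrow> s m \<in> carrier Z2xZ2"
    and c: "\<And>m. m \<in> carrier M \<Longrightarrow> c m \<in> carrier C"
    and d: "\<And>m x. \<lbrakk>m \<in> carrier M; x \<in> {0, 1} \<times> {0, 1}\<rbrakk> \<Longrightarrow> d m x \<in> carrier D"
    and e: "\<And>m x. \<lbrakk>m \<in> carrier M; x \<in> {0, 1}\<rbrakk> \<Longrightarrow> e m x \<in> carrier H"
    and f: "\<And>m x. \<lbrakk>m \<in> carrier M; x \<in> {0, 1}\<rbrakk> \<Longrightarrow> f m x \<in> carrier K"
    and s_mult: "\<And>m n. \<lbrakk>m \<in> carrier M; n \<in> carrier M\<rbrakk> \<Longrightarrow> s (m \<otimes>\<^bsub>M\<^esub> n) = s m \<otimes>\<^bsub>Z2xZ2\<^esub> s n"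
    and c_mult: "\<And>m n. \<lbrakk>m \<in> carrier M; n \<in> carrier M\<rbrakk> \<Longrightarrow> c (m \<otimes>\<^bsub>M\<^esub> n) = c m \<otimes>\<^bsub>C\<^esub> c n"
    and d_mult: "\<And>m n x. \<lbrakk>m \<in> carrier M; n \<in> carrier M; x \<in> {0, 1} \<times> {0, 1}\<rbrakk>
      \<Longrightarrow> d (m \<otimes>\<^bsub>M\<^esub> n) x = d m (s n \<otimes>\<^bsub>Z2xZ2\<^esub> x) \<otimes>\<^bsub>D\<^esub> d n x"
    and e_mult: "\<And>m n x. \<lbrakk>m \<in> carrier M; n \<in> carrier M; x \<in> {0, 1}\<rbrakk>
      \<Longrightarrow> e (m \<otimes>\<^bsub>M\<^esub> n) x = e m ((fst (s n) + x) mod 2) \<otimes>\<^bsub>H\<^esub> e n x"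
    and f_mult: "\<And>m n x. \<lbrakk>m \<in> carrier M; n \<in> carrier M; x \<in> {0, 1}\<rbrakk>
      \<Longrightarrow> f (m \<otimes>\<^bsub>M\<^esub> n) x = f m ((snd (s n) + x) mod 2) \<otimes>\<^bsub>K\<^esub> f n x"
    and inj: "\<And>m n. \<lbrakk>m \<in> carrier M; n \<in> carrier M; s m = s n; c m = c n;
      \<And>x. x \<in> {0, 1} \<times> {0, 1} \<Longrightarrow> d m x = d n x; \<And>x. x \<in> {0, 1} \<Longrightarrow> e m x = e n x;
      \<And>x. x \<in> {0, 1} \<Longrightarrow> f m x = f n x\<rbrakk> \<Longrightarrow> m = n"
    and surj: "\<And>s' c' d' e' f'. \<lbrakk>s' \<in> carrier Z2xZ2; c' \<in> carrier C;
      \<And>x. x \<in> {0, 1} \<times> {0, 1} \<Longrightarrow> d' x \<in> carrier D; \<And>x. x \<in> {0, 1} \<Longrightarrow> e' x \<in> carrier H;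
      \<And>x. x \<in> {0, 1} \<Longrightarrow> f' x \<in> carrier K\<rbrakk>
      \<Longrightarrow> \<exists>m\<in>carrier M. s m = s' \<and> c m = c' \<and> (\<forall>x\<in>{0, 1} \<times> {0, 1}. d m x = d' x) \<and>
        (\<forall>x\<in>{0, 1}. e m x = e' x) \<and> (\<forall>x\<in>{0, 1}. f m x = f' x)"
  shows "\<exists>(V :: nat set) (E :: nat set set). bicyclic V E \<and> M \<cong> Aut V E"
proof -
  let ?B = "{0, 1} :: int set"
  obtain NC tC iC where tC: "\<And>n. NC \<le> n \<Longrightarrow> rooted_tree (tC n :: nat rtree)"
    "\<And>n. NC \<le> n \<Longrightarrow> card (verts (tC n)) = n" "\<And>n. NC \<le> n \<Longrightarrow> iC n \<in> iso C (tree_aut (tC n))"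
    using \<T>_nat_trees[OF \<T>(1)] by blast
  obtain ND tD iD where tD: "\<And>n. ND \<le> n \<Longrightarrow> rooted_tree (tD n :: nat rtree)"
    "\<And>n. ND \<le> n \<Longrightarrow> card (verts (tD n)) = n" "\<And>n. ND \<le> n \<Longrightarrow> iD n \<in> iso D (tree_aut (tD n))"
    using \<T>_nat_trees[OF \<T>(2)] by blast
  obtain NH tH iH where tH: "\<And>n. NH \<le> n \<Longrightarrow> rooted_tree (tH n :: nat rtree)"
    "\<And>n. NH \<le> n \<Longrightarrow> card (verts (tH n)) = n" "\<And>n. NH \<le> n \<Longrightarrow> iH n \<in> iso H (tree_aut (tH n))"
    using \<T>_nat_trees[OF \<T>(3)] by blast
  obtain NK tK iK where tK: "\<And>n. NK \<le> n \<Longrightarrow> rooted_tree (tK n :: nat rtree)"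
    "\<And>n. NK \<le> n \<Longrightarrow> card (verts (tK n)) = n" "\<And>n. NK \<le> n \<Longrightarrow> iK n \<in> iso K (tree_aut (tK n))"
    using \<T>_nat_trees[OF \<T>(4)] by blast
  \<comment> \<open>The sum is at least each of the four thresholds. The sizes from \<open>N\<close>
    to \<open>N + 3\<close> are used, one for each orbit on the core.\<close>
  define N where "N = NC + ND + NH + NK"
  have N: "NC \<le> N" "ND \<le> N + 1" "NH \<le> N + 2" "NK \<le> N + 3" by (simp_all add: N_def)
  define T where "T x = (if fst x = 2 then if snd x = 2 then tC N else tK (N + 3)
    else if snd x = 2 then tH (N + 2) else tD (N + 1))" for x :: "int \<times> int"
  note iC = isoD[OF tC(3)[OF N(1)]] and iD = isoD[OF tD(3)[OF N(2)]]
    and iH = isoD[OF tH(3)[OF N(3)]] and iK = isoD[OF tK(3)[OF N(4)]]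
  define \<gamma> where "\<gamma> m x = (if fst x = 2 then if snd x = 2 then iC N (c m) else iK (N + 3) (f m (snd x))
    else if snd x = 2 then iH (N + 2) (e m (fst x)) else iD (N + 1) (d m x))" for m and x :: "int \<times> int"
  have tree: "rooted_tree (T x)" for x
    using tC(1)[OF N(1)] tD(1)[OF N(2)] tH(1)[OF N(3)] tK(1)[OF N(4)] by (simp add: T_def)
  have card: "card (verts (T x)) = (if fst x = 2 then if snd x = 2 then N else N + 3
    else if snd x = 2 then N + 2 else N + 1)" for x
    using tC(2)[OF N(1)] tD(2)[OF N(2)] tH(2)[OF N(3)] tK(2)[OF N(4)] by (simp add: T_def)
  have T_eq: "T x = T y \<longleftrightarrow> (fst x = 2 \<longleftrightarrow> fst y = 2) \<and> (snd x = 2 \<longleftrightarrow> snd y = 2)" for x y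
  proof
    assume "T x = T y"
    then have "card (verts (T x)) = card (verts (T y))" by simp
    then show "(fst x = 2 \<longleftrightarrow> fst y = 2) \<and> (snd x = 2 \<longleftrightarrow> snd y = 2)"
      unfolding card by (simp split: if_splits)
  qed (simp add: T_def)
  have coreD: "fst x = 2 \<or> fst x \<in> ?B" "snd x = 2 \<or> snd x \<in> ?B" if "x \<in> core" for x
    using that by (auto simp: core_def)
  have B_core: "(2, 2) \<in> core" "x \<in> ?B \<times> ?B \<Longrightarrow> x \<in> core" "b \<in> ?B \<Longrightarrow> (b, 2) \<in> core"
    "b \<in> ?B \<Longrightarrow> (2, b) \<in> core" for x b by (auto simp: core_def)
  have B2: "b \<noteq> 2" if "b \<in> ?B" for b using that by auto
  have \<gamma>_at: "\<gamma> m (2, 2) = iC N (c m)" "x \<in> ?B \<times> ?B \<Longrightarrow> \<gamma> m x = iD (N + 1) (d m x)"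
    "b \<in> ?B \<Longrightarrow> \<gamma> m (b, 2) = iH (N + 2) (e m b)" "b \<in> ?B \<Longrightarrow> \<gamma> m (2, b) = iK (N + 3) (f m b)"
    for m x b using B2 by (auto simp: \<gamma>_def)
  have T_at: "T (2, 2) = tC N" "x \<in> ?B \<times> ?B \<Longrightarrow> T x = tD (N + 1)"
    "b \<in> ?B \<Longrightarrow> T (b, 2) = tH (N + 2)" "b \<in> ?B \<Longrightarrow> T (2, b) = tK (N + 3)"
    for x b using B2 by (auto simp: T_def)
  \<comment> \<open>One case for each orbit: the fixed point, the regular orbit, the midpoints of
    the long paths and the hubs.\<close>
  have core_split: "Q x" if "x \<in> core" "Q (2, 2)" "\<And>x. x \<in> ?B \<times> ?B \<Longrightarrow> Q x"
    "\<And>b. b \<in> ?B \<Longrightarrow> Q (b, 2)" "\<And>b. b \<in> ?B \<Longrightarrow> Q (2, b)" for Q :: "int \<times> int \<Rightarrow> bool" and x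
    using coreD[OF that(1)] that(2-) by (metis mem_Sigma_iff prod.collapse)
  have mod_B: "b mod 2 \<in> ?B" for b :: int by auto
  have translate_at: "translate k (2, 2) = (2, 2)" "x \<in> ?B \<times> ?B \<Longrightarrow> translate k x = k \<otimes>\<^bsub>Z2xZ2\<^esub> x"
    "b \<in> ?B \<Longrightarrow> translate k (b, 2) = ((fst k + b) mod 2, 2)"
    "b \<in> ?B \<Longrightarrow> translate k (2, b) = (2, (snd k + b) mod 2)" for k x b
    using B2 by (auto simp: translate_def Z2xZ2_mult[of "fst k" "snd k", simplified] add.commute)
  have mult_B: "k \<otimes>\<^bsub>Z2xZ2\<^esub> x \<in> ?B \<times> ?B" for k x
    by (cases k; cases x) (simp only: Z2xZ2_mult mem_Sigma_iff mod_B)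
  have "M \<cong> forest_aut core T core_adj"
  proof (rule iso_forest_aut[where act = "\<lambda>m. translate (s m)" and \<gamma> = \<gamma>], goal_cases)
    case (3 x y)
    then show ?case unfolding card T_eq by (simp split: if_splits)
  next
    case (5 m x)
    then show ?case unfolding T_eq using translate_core(2,3)[OF s] by simp
  next
    case (7 m x)
    from 7(2) show ?case
      by (rule core_split) (use 7(1) iC(1) iD(1) iH(1) iK(1) c d e f in \<open>simp_all only: \<gamma>_at T_at\<close>)
  next
    case (9 m n x)
    note mn = 9(1,2)
    from 9(3) show ?case
    proof (rule core_split)
      show "\<gamma> (m \<otimes>\<^bsub>M\<^esub> n) (2, 2) = \<gamma> m (translate (s n) (2, 2)) \<otimes>\<^bsub>tree_aut (T (2, 2))\<^esub> \<gamma> n (2, 2)"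
        using mn iC(2) c c_mult by (simp only: \<gamma>_at T_at translate_at)
      show "\<gamma> (m \<otimes>\<^bsub>M\<^esub> n) x = \<gamma> m (translate (s n) x) \<otimes>\<^bsub>tree_aut (T x)\<^esub> \<gamma> n x"
        if "x \<in> ?B \<times> ?B" for x
        using mn that iD(2) d d_mult mult_B by (simp only: \<gamma>_at T_at translate_at)
      show "\<gamma> (m \<otimes>\<^bsub>M\<^esub> n) (b, 2) = \<gamma> m (translate (s n) (b, 2)) \<otimes>\<^bsub>tree_aut (T (b, 2))\<^esub> \<gamma> n (b, 2)"
        if "b \<in> ?B" for b
        using mn that iH(2) e e_mult mod_B by (simp only: \<gamma>_at T_at translate_at)
      show "\<gamma> (m \<otimes>\<^bsub>M\<^esub> n) (2, b) = \<gamma> m (translate (s n) (2, b)) \<otimes>\<^bsub>tree_aut (T (2, b))\<^esub> \<gamma> n (2, b)"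
        if "b \<in> ?B" for b
        using mn that iK(2) f f_mult mod_B by (simp only: \<gamma>_at T_at translate_at)
    qed
  next
    case (10 m n)
    note mn = 10(1,2)
    \<comment> \<open>The acting element is recovered from its effect on one midpoint and one
      hub.\<close>
    have "((fst (s m) + 0) mod 2, (2 :: int)) = ((fst (s n) + 0) mod 2, 2)"
      "((2 :: int), (snd (s m) + 0) mod 2) = (2, (snd (s n) + 0) mod 2)"
      using 10(3)[of "(0, 2)"] 10(3)[of "(2, 0)"] by (simp_all add: translate_at core_def)
    then have sm: "s m = s n"
      using s[OF mn(1)] s[OF mn(2)] by (auto simp: carrier_Z2xZ2 prod_eq_iff)
    have cm: "c m = c n"
      by (rule iC(3)[OF c[OF mn(1)] c[OF mn(2)]]) (use 10(4)[OF B_core(1)] in \<open>simp only: \<gamma>_at\<close>)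
    have dm: "d m x = d n x" if "x \<in> ?B \<times> ?B" for x
      by (rule iD(3)[OF d[OF mn(1) that] d[OF mn(2) that]])
        (use 10(4)[OF B_core(2)[OF that]] that in \<open>simp only: \<gamma>_at\<close>)
    have em: "e m x = e n x" if "x \<in> ?B" for x
      by (rule iH(3)[OF e[OF mn(1) that] e[OF mn(2) that]])
        (use 10(4)[OF B_core(3)[OF that]] that in \<open>simp only: \<gamma>_at\<close>)
    have fm: "f m x = f n x" if "x \<in> ?B" for x
      by (rule iK(3)[OF f[OF mn(1) that] f[OF mn(2) that]])
        (use 10(4)[OF B_core(4)[OF that]] that in \<open>simp only: \<gamma>_at\<close>)
    show ?case by (rule inj[OF mn sm cm]) (erule dm em fm)+
  next
    case (11 \<sigma> g)
    have "\<exists>k\<in>carrier Z2xZ2. \<forall>x\<in>core. \<sigma> x = translate k x"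
      by (rule core_aut_is_translation) (use 11 T_eq in blast)+
    then obtain k where k: "k \<in> carrier Z2xZ2" "\<And>x. x \<in> core \<Longrightarrow> \<sigma> x = translate k x" by blast
    obtain c' where c': "c' \<in> carrier C" "iC N c' = g (2, 2)"
      using iC(4) 11(4)[OF B_core(1)] by (auto simp: T_at)
    have "\<forall>x\<in>?B \<times> ?B. \<exists>a. a \<in> carrier D \<and> iD (N + 1) a = g x"
      using iD(4) 11(4)[OF B_core(2)] T_at(2) by metis
    from bchoice[OF this] obtain d' where d': "\<forall>x\<in>?B \<times> ?B. d' x \<in> carrier D \<and> iD (N + 1) (d' x) = g x"
      by blast
    have "\<forall>x\<in>?B. \<exists>a. a \<in> carrier H \<and> iH (N + 2) a = g (x, 2)"
      using iH(4) 11(4)[OF B_core(3)] T_at(3) by metis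
    from bchoice[OF this] obtain e' where e': "\<forall>x\<in>?B. e' x \<in> carrier H \<and> iH (N + 2) (e' x) = g (x, 2)"
      by blast
    have "\<forall>x\<in>?B. \<exists>a. a \<in> carrier K \<and> iK (N + 3) a = g (2, x)"
      using iK(4) 11(4)[OF B_core(4)] T_at(4) by metis
    from bchoice[OF this] obtain f' where f': "\<forall>x\<in>?B. f' x \<in> carrier K \<and> iK (N + 3) (f' x) = g (2, x)"
      by blast
    have "\<exists>m\<in>carrier M. s m = k \<and> c m = c' \<and> (\<forall>x\<in>?B \<times> ?B. d m x = d' x) \<and>
        (\<forall>x\<in>?B. e m x = e' x) \<and> (\<forall>x\<in>?B. f m x = f' x)"
      by (rule surj) (use k c' d' e' f' in blast)+
    then obtain m where m: "m \<in> carrier M" "s m = k" "c m = c'" "\<forall>x\<in>?B \<times> ?B. d m x = d' x"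
      "\<forall>x\<in>?B. e m x = e' x" "\<forall>x\<in>?B. f m x = f' x" by blast
    have "\<gamma> m x = g x" if "x \<in> core" for x
      using that by (rule core_split) (use m c' d' e' f' in \<open>simp_all only: \<gamma>_at\<close>)
    then show ?case using m(1,2) k(2) by auto
  next
    case (4 m)
    then show ?case by (intro translate_core s)
  next
    case (6 m x y)
    then show ?case by (intro translate_core s)
  next
    case (8 m n x)
    then show ?case by (simp only: s_mult translate_mult)
  qed (use tree in \<open>simp_all add: core_def\<close>)
  then show ?thesis using bicyclic_core_attach tree by blast
qed

text \<open>On the points \<open>(i, j)\<close> the translations are the regular action used in the
  wreath product; midpoints and hubs get the trivial group.\<close>

lemma \<B>1_bicyclic:
  assumes "C \<in> \<T>_nat" "D \<in> \<T>_nat"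
  shows "\<exists>(V :: nat set) (E :: nat set set). bicyclic V E \<and> C \<times>\<times> wreath_Z2xZ2 D \<cong> Aut V E"
proof -
  let ?B = "{0, 1} \<times> {0, 1} :: (int \<times> int) set"
  have car: "carrier (wreath_Z2xZ2 D) = carrier Z2xZ2 \<times> (?B \<rightarrow>\<^sub>E carrier D)"
    by (simp add: wreath_Z2xZ2_def wreath_def carrier_Z2xZ2)
  have mult: "(k, f) \<otimes>\<^bsub>wreath_Z2xZ2 D\<^esub> (k', f') =
    (k \<otimes>\<^bsub>Z2xZ2\<^esub> k', \<lambda>x\<in>?B. f (k' \<otimes>\<^bsub>Z2xZ2\<^esub> x) \<otimes>\<^bsub>D\<^esub> f' x)" for k f k' f'
    by (simp add: wreath_Z2xZ2_def wreath_def carrier_Z2xZ2)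
  show ?thesis
  proof (rule core_group_bicyclic[OF assms one_group_\<T>_nat one_group_\<T>_nat, where s = "\<lambda>m. fst (snd m)"
        and c = fst and d = "\<lambda>m. snd (snd m)" and e = "\<lambda>_ _. 0" and f = "\<lambda>_ _. 0"], goal_cases)
    case (3 m x)
    then have "snd (snd m) \<in> ?B \<rightarrow>\<^sub>E carrier D" by (simp add: car mem_Times_iff)
    then show ?case using 3(2) by (rule PiE_mem)
  next
    case (6 m n)
    show ?case by (cases m; cases n) (auto simp: mult)
  next
    case (7 m n)
    show ?case by (cases m; cases n) (auto simp: mult)
  next
    case (8 m n x)
    then show ?case by (cases m; cases n) (auto simp: mult simp del: mem_Sigma_iff)
  next
    case (11 m n)
    have "snd (snd m) = snd (snd n)"
      by (rule PiE_ext[of _ ?B "\<lambda>_. carrier D"]) (use 11(1,2,5) in \<open>simp_all add: car mem_Times_iff\<close>)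
    with 11(3,4) show ?case by (simp add: prod_eq_iff)
  next
    case (12 s' c' d' e' f')
    have "restrict d' ?B \<in> ?B \<rightarrow>\<^sub>E carrier D"
      using 12(3) by (auto simp del: mem_Sigma_iff insert_iff)
    with 12(1,2) have "(c', s', restrict d' ?B) \<in> carrier (C \<times>\<times> wreath_Z2xZ2 D)"
      by (simp add: car)
    then show ?case by (rule rev_bexI) (use 12(4,5) in simp)
  qed (simp_all add: car mem_Times_iff)
qed

text \<open>In \<open>semidirect\<close> the action twists the second factor, whereas composition of
  forest automorphisms evaluates the first factor at a moved point. The two conventions are matched
  by reading the component of \<open>(n, k)\<close> at \<open>x\<close> from the coordinate of
  \<open>n\<close> at \<open>k \<otimes> x\<close>, using that every \<open>k\<close> is an
  involution.\<close>

lemma \<B>2_bicyclic: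
  fixes C D H K :: "nat monoid"
  assumes "C \<in> \<T>_nat" "D \<in> \<T>_nat" "H \<in> \<T>_nat" "K \<in> \<T>_nat"
  shows "\<exists>(V :: nat set) (E :: nat set set). bicyclic V E \<and>
    C \<times>\<times> semidirect (D \<times>\<times> D \<times>\<times> D \<times>\<times> D \<times>\<times> H \<times>\<times> H \<times>\<times> K \<times>\<times> K) Z2xZ2 phi \<cong> Aut V E"
proof -
  let ?N = "D \<times>\<times> D \<times>\<times> D \<times>\<times> D \<times>\<times> H \<times>\<times> H \<times>\<times> K \<times>\<times> K"
  let ?M = "C \<times>\<times> semidirect ?N Z2xZ2 phi"
  have car: "carrier ?M = carrier C \<times> (carrier ?N \<times> carrier Z2xZ2)"
    and mult: "(c, n, k) \<otimes>\<^bsub>?M\<^esub> (c', n', k') = (c \<otimes>\<^bsub>C\<^esub> c', n \<otimes>\<^bsub>?N\<^esub> phi k n', k \<otimes>\<^bsub>Z2xZ2\<^esub> k')"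
    for c n k c' n' k'
    by (simp_all add: semidirect_def)
  \<comment> \<open>With \<open>\<alpha>\<close>, \<open>\<beta>\<close>, \<open>\<gamma>\<close>,
    \<open>\<delta>\<close> placed at \<open>(0, 0)\<close>, \<open>(1, 0)\<close>,
    \<open>(0, 1)\<close>, \<open>(1, 1)\<close>, the permutations in \<open>phi\<close> become
    translations of the index. The two coordinates from \<open>H\<close> are exchanged according to
    the first component of the acting element, those from \<open>K\<close> according to the second;
    hence they belong to the midpoints and to the hubs.\<close>
  define d :: "nat \<times> nat \<times> nat \<times> nat \<times> nat \<times> nat \<times> nat \<times> nat \<Rightarrow> int \<times> int \<Rightarrow> nat"
    where "d = (\<lambda>(\<alpha>, \<beta>, \<gamma>, \<delta>, l, l', s, s') x.
      if x = (0, 0) then \<alpha> else if x = (1, 0) then \<beta> else if x = (0, 1) then \<gamma> else \<delta>)"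
  define e f :: "nat \<times> nat \<times> nat \<times> nat \<times> nat \<times> nat \<times> nat \<times> nat \<Rightarrow> int \<Rightarrow> nat"
    where "e = (\<lambda>(\<alpha>, \<beta>, \<gamma>, \<delta>, l, l', s, s') x. if x = 0 then l else l')"
      and "f = (\<lambda>(\<alpha>, \<beta>, \<gamma>, \<delta>, l, l', s, s') x. if x = 0 then s else s')"
  note defs = d_def e_def f_def
  have n_eq: "n = (d n (0, 0), d n (1, 0), d n (0, 1), d n (1, 1), e n 0, e n 1, f n 0, f n 1)" for n
    by (simp add: defs split: prod.split)
  \<comment> \<open>Any other index falls back to the last coordinate, so quantifying over all
    \<open>x\<close> covers just the eight coordinates.\<close>
  have N_car: "n \<in> carrier ?N \<longleftrightarrow> (\<forall>x. d n x \<in> carrier D) \<and> (\<forall>x. e n x \<in> carrier H) \<and> (\<forall>x. f n x \<in> carrier K)"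
    for n
  proof
    show "n \<in> carrier ?N" if "(\<forall>x. d n x \<in> carrier D) \<and> (\<forall>x. e n x \<in> carrier H) \<and> (\<forall>x. f n x \<in> carrier K)"
      using that by (subst n_eq) simp
  qed (auto simp: defs)
  have N_mult: "d (n \<otimes>\<^bsub>?N\<^esub> n') x = d n x \<otimes>\<^bsub>D\<^esub> d n' x" "e (n \<otimes>\<^bsub>?N\<^esub> n') y = e n y \<otimes>\<^bsub>H\<^esub> e n' y"
    "f (n \<otimes>\<^bsub>?N\<^esub> n') y = f n y \<otimes>\<^bsub>K\<^esub> f n' y" for n n' x y
    by (simp_all add: defs split: prod.split)
  interpret Z: group Z2xZ2 by (rule group_Z2xZ2)
  let ?B = "{0, 1} \<times> {0, 1} :: (int \<times> int) set"
  have Z_car: "carrier Z2xZ2 = ?B" by (rule carrier_Z2xZ2)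
  have involution: "k \<otimes>\<^bsub>Z2xZ2\<^esub> (k \<otimes>\<^bsub>Z2xZ2\<^esub> x) = x" if "k \<in> carrier Z2xZ2" "x \<in> carrier Z2xZ2" for k x
    using Z2xZ2_cases[OF that(1)] Z2xZ2_cases[OF that(2)]
    by (elim disjE) (simp_all add: Z2xZ2_mult)
  have fst_mult: "fst (k \<otimes>\<^bsub>Z2xZ2\<^esub> k') = (fst k + fst k') mod 2"
    and snd_mult: "snd (k \<otimes>\<^bsub>Z2xZ2\<^esub> k') = (snd k + snd k') mod 2" for k k'
    by (cases k; cases k'; simp add: Z2xZ2_mult)+
  \<comment> \<open>These rules do for the coordinates from \<open>H\<close> and \<open>K\<close>
    what associativity and \<open>involution\<close> do for those from \<open>D\<close>.\<close>
  have mod2: "(a + (a + b) mod 2) mod 2 = b mod 2" "(a + (a + b)) mod 2 = b mod 2" "((a + b) mod 2 + c) mod 2 = (a + (b + c) mod 2) mod 2"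
    for a b c :: int
    by presburger+
  have phi: "d (phi k n) x = d n (k \<otimes>\<^bsub>Z2xZ2\<^esub> x)" if "k \<in> carrier Z2xZ2" "x \<in> carrier Z2xZ2" for k n x
    using Z2xZ2_cases[OF that(1)] Z2xZ2_cases[OF that(2)]
    by (elim disjE) (simp_all add: Z2xZ2_mult phi_def d_def split: prod.split)
  have phi': "e (phi k n) (b mod 2) = e n ((fst k + b) mod 2)" "f (phi k n) (b mod 2) = f n ((snd k + b) mod 2)"
    if "k \<in> carrier Z2xZ2" for k n b
  proof -
    have "b mod 2 = 0 \<and> (1 + b) mod 2 = 1 \<or> b mod 2 = 1 \<and> (1 + b) mod 2 = 0" by presburger
    then show "e (phi k n) (b mod 2) = e n ((fst k + b) mod 2)"
      "f (phi k n) (b mod 2) = f n ((snd k + b) mod 2)"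
      using Z2xZ2_cases[OF that]
      by (elim disjE conjE; simp only: phi_def defs; simp split: prod.split)+
  qed
  have mod_B: "b mod 2 \<in> {0, 1}" for b :: int by auto
  have mod_id: "x mod 2 = x" if "x \<in> {0, 1}" for x :: int
    using that by auto
  show ?thesis
  proof (rule core_group_bicyclic[OF assms, where s = "\<lambda>m. snd (snd m)" and c = fst
        and d = "\<lambda>m x. d (fst (snd m)) (snd (snd m) \<otimes>\<^bsub>Z2xZ2\<^esub> x)"
        and e = "\<lambda>m x. e (fst (snd m)) ((fst (snd (snd m)) + x) mod 2)"
        and f = "\<lambda>m x. f (fst (snd m)) ((snd (snd (snd m)) + x) mod 2)"], goal_cases)
    case (1 m)
    then show ?case unfolding car by auto
  next
    case (2 m)
    then show ?case unfolding car by auto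
  next
    case (3 m x)
    then have "fst (snd m) \<in> carrier ?N" unfolding car by auto
    then show ?case unfolding N_car by blast
  next
    case (4 m x)
    then have "fst (snd m) \<in> carrier ?N" unfolding car by auto
    then show ?case unfolding N_car by blast
  next
    case (5 m x)
    then have "fst (snd m) \<in> carrier ?N" unfolding car by auto
    then show ?case unfolding N_car by blast
  next
    case (6 m m')
    then show ?case by (cases m; cases m') (simp only: mult fst_conv snd_conv)
  next
    case (7 m m')
    then show ?case by (cases m; cases m') (simp only: mult fst_conv snd_conv)
  next
    case (8 m m' x)
    obtain c n k c' n' k' where m: "m = (c, n, k)" "m' = (c', n', k')" by (metis prod.collapse)
    then have "k \<in> carrier Z2xZ2" "k' \<in> carrier Z2xZ2" "x \<in> carrier Z2xZ2"
      using 8 unfolding car Z_car[symmetric] by auto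
    then show ?case
      by (simp only: m mult fst_conv snd_conv N_mult phi Z.m_closed Z.m_assoc involution)
  next
    case (9 m m' x)
    obtain c n k c' n' k' where m: "m = (c, n, k)" "m' = (c', n', k')" by (metis prod.collapse)
    then have "k \<in> carrier Z2xZ2" using 9 unfolding car by auto
    then show ?case
      by (simp only: m mult fst_conv snd_conv N_mult phi' fst_mult mod2 mod_mod_trivial)
  next
    case (10 m m' x)
    obtain c n k c' n' k' where m: "m = (c, n, k)" "m' = (c', n', k')" by (metis prod.collapse)
    then have "k \<in> carrier Z2xZ2" using 10 unfolding car by auto
    then show ?case
      by (simp only: m mult fst_conv snd_conv N_mult phi' snd_mult mod2 mod_mod_trivial)
  next
    case (11 m m')
    obtain c n k c' n' k' where m: "m = (c, n, k)" "m' = (c', n', k')" by (metis prod.collapse)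
    with 11 have k: "k' = k" "c' = c" "k \<in> carrier Z2xZ2" unfolding car by auto
    have d: "d n x = d n' x" if "x \<in> ?B" for x
      using 11(5)[of "k \<otimes>\<^bsub>Z2xZ2\<^esub> x"] that k(3) involution[of k x] Z.m_closed[of k x]
      by (simp only: m k fst_conv snd_conv Z_car)
    have e: "e n x = e n' x" "f n x = f n' x" if "x \<in> {0, 1}" for x
      using 11(6)[OF mod_B[of "fst k + x"]] 11(7)[OF mod_B[of "snd k + x"]] mod_id[OF that]
      by (simp_all add: m k mod2(1))
    have "n = n'"
      by (subst n_eq, subst (2) n_eq) (use d e in simp)
    then show ?case by (simp only: m k)
  next
    case (12 k c' d' e' f')
    \<comment> \<open>The twist is applied in advance: reading \<open>n\<close> at
      \<open>k \<otimes> x\<close> then returns the value prescribed at \<open>x\<close>.\<close>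
    define n where "n = (d' (k \<otimes>\<^bsub>Z2xZ2\<^esub> (0, 0)), d' (k \<otimes>\<^bsub>Z2xZ2\<^esub> (1, 0)), d' (k \<otimes>\<^bsub>Z2xZ2\<^esub> (0, 1)),
      d' (k \<otimes>\<^bsub>Z2xZ2\<^esub> (1, 1)), e' ((fst k + 0) mod 2), e' ((fst k + 1) mod 2),
      f' ((snd k + 0) mod 2), f' ((snd k + 1) mod 2))"
    have mult_B: "k \<otimes>\<^bsub>Z2xZ2\<^esub> x \<in> ?B" for x
      by (cases k; cases x) (simp only: Z2xZ2_mult mem_Sigma_iff mod_B)
    have dn: "d n x = d' (k \<otimes>\<^bsub>Z2xZ2\<^esub> x)" if "x \<in> carrier Z2xZ2" for x
      using Z2xZ2_cases[OF that] by (elim disjE) (simp_all add: n_def d_def)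
    have en: "e n x = e' ((fst k + x) mod 2)" "f n x = f' ((snd k + x) mod 2)" if "x \<in> {0, 1}" for x
      using that by (auto simp: n_def e_def f_def)
    have "n \<in> carrier ?N"
      unfolding n_def carrier_DirProd
      by (intro SigmaI 12(3)[OF mult_B] 12(4)[OF mod_B] 12(5)[OF mod_B])
    then have "(c', n, k) \<in> carrier ?M"
      unfolding car by (intro SigmaI 12(1,2))
    moreover have "d n (k \<otimes>\<^bsub>Z2xZ2\<^esub> x) = d' x" if "x \<in> ?B" for x
      using that 12(1) dn[of "k \<otimes>\<^bsub>Z2xZ2\<^esub> x"] involution[of k x] mult_B by (simp only: Z_car)
    moreover have "e n ((fst k + x) mod 2) = e' x" "f n ((snd k + x) mod 2) = f' x" if "x \<in> {0, 1}" for x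
      using en[OF mod_B] mod_id[OF that] by (simp_all add: mod2(1))
    ultimately show ?case
      by (intro bexI[of _ "(c', n, k)"] conjI ballI; simp only: fst_conv snd_conv)
  qed
qed

theorem theorem3p9:
  fixes G :: "'a monoid"
  assumes "G \<in> \<S>"
  shows "\<exists>(V :: nat set) (E :: nat set set). bicyclic V E \<and> G \<cong> Aut V E"
proof -
  from assms consider C where "C \<in> \<T>_nat" "G \<cong> C"
    | C D where "C \<in> \<T>_nat" "D \<in> \<T>_nat" "G \<cong> C \<times>\<times> wreath_Z2xZ2 D"
    | C D H K where "C \<in> \<T>_nat" "D \<in> \<T>_nat" "H \<in> \<T>_nat" "K \<in> \<T>_nat"
      "G \<cong> C \<times>\<times> semidirect (D \<times>\<times> D \<times>\<times> D \<times>\<times> D \<times>\<times> H \<times>\<times> H \<times>\<times> K \<times>\<times> K) Z2xZ2 phi"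
    unfolding \<S>_def \<T>_def \<B>1_def \<B>2_def by blast
  then show ?thesis
  proof cases
    case 1
    then show ?thesis using \<T>_bicyclic[OF 1(1)] iso_trans by blast
  next
    case 2
    then show ?thesis using \<B>1_bicyclic[OF 2(1,2)] iso_trans by blast
  next
    case 3
    then show ?thesis using \<B>2_bicyclic[OF 3(1-4)] iso_trans by blast
  qed
qed

end
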